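(* If MA($\sigma$-$n$-linked) holds for some $n\in[1,\omega)$, then every cofinally scalene neighborhood filter in $\beta\omega\setminus\omega$ is cofinally equivalent to $\mathfrak{c}$.
   Context: $\mathfrak{c}=2^{\aleph_0}$. $\beta\omega\setminus\omega$ is the Stone–Čech remainder of the discrete space $\omega$. A neighborhood filter in a space $X$ is a set $\mathrm{Nbhd}(p,X)$ with $p\in X$, consisting of all $U\subseteq X$ such that $p$ is in the interior of $U$, preordered by containment $\supseteq$ (smaller neighborhoods are greater). Preorders $P$ and $Q$ are cofinally equivalent if there is a preorder $R$ such that $P$ and $Q$ are order isomorphic to cofinal subsets of $R$. $\mathrm{Reg}$ is the class of regular cardinals, where by convention $1$ is the unique finite regular cardinal. A preorder is cofinally scalene if it is cofinally equivalent to $\prod S$ for some set $S\subseteq\mathrm{Reg}$, where $\prod S$ is the set of functions $f$ on $S$ with $f(\mu)\in\mu$ for all $\mu\in S$, ordered coordinatewise (and $\prod\varnothing=\{\varnothing\}$). A forcing $\mathbb{P}$ is $\sigma$-$n$-linked if it is a union of countably many subsets, each of which is $n$-linked, meaning that any $n$ of its elements have a common lower bound in $\mathbb{P}$. MA($\sigma$-$n$-linked) is the assertion that for every $\sigma$-$n$-linked forcing $\mathbb{P}$ and every family $\mathcal{D}$ of fewer than $\mathfrak{c}$ dense subsets of $\mathbb{P}$ there is a filter of $\mathbb{P}$ meeting every member of $\mathcal{D}$ (CH is not excluded; for $n=1$ this assertion is equivalent to CH). *)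

theory Defs
  imports "HOL-Analysis.Analysis"
begin

unbundle cardinal_syntax
no_notation elt_set_eq (infix "=o" 50)

text \<open>
  A preorder is a relation \<open>r\<close> with \<open>Preorder r\<close>; its underlying set is \<open>Field r\<close>, and
  \<open>(x, y) \<in> r\<close> means \<open>x \<le> y\<close>. Cardinals are the \<open>Card_order\<close> relations of the library.
\<close>

section \<open>Cofinal equivalence\<close>

text \<open>The library's \<open>cofinal\<close> demands strictly larger elements, which is wrong for preorders
  with maximal elements.\<close>

definition cofinal_subset :: "'a set \<Rightarrow> 'a rel \<Rightarrow> bool" where
  "cofinal_subset C r \<longleftrightarrow> C \<subseteq> Field r \<and> (\<forall>x\<in>Field r. \<exists>c\<in>C. (x, c) \<in> r)"

definition order_isomorphic :: "'a rel \<Rightarrow> 'b rel \<Rightarrow> bool" where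
  "order_isomorphic r s \<longleftrightarrow>
     (\<exists>h. bij_betw h (Field r) (Field s) \<and>
          (\<forall>x\<in>Field r. \<forall>y\<in>Field r. (x, y) \<in> r \<longleftrightarrow> (h x, h y) \<in> s))"

text \<open>The ambient preorder lives on the sum of the two types. This is no restriction: see
  \<open>cofinally_equivI\<close>, where it may live on any type.\<close>

definition cofinally_equiv :: "'a rel \<Rightarrow> 'b rel \<Rightarrow> bool" where
  "cofinally_equiv P Q \<longleftrightarrow>
     (\<exists>R :: ('a + 'b) rel. Preorder R \<and>
        (\<exists>C. cofinal_subset C R \<and> order_isomorphic P (Restr R C)) \<and>
        (\<exists>D. cofinal_subset D R \<and> order_isomorphic Q (Restr R D)))"

lemma Field_Restr_Preorder:
  assumes "Preorder R" "C \<subseteq> Field R"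
  shows "Field (Restr R C) = C"
proof
  show "Field (Restr R C) \<subseteq> C" unfolding Field_def by auto
  show "C \<subseteq> Field (Restr R C)"
  proof
    fix x assume "x \<in> C"
    then have "(x, x) \<in> Restr R C" using assms unfolding preorder_on_def refl_on_def by auto
    then show "x \<in> Field (Restr R C)" by (rule FieldI1)
  qed
qed

lemma cofinally_equivI:
  fixes P :: "'a rel" and Q :: "'b rel" and R :: "'c rel"
  assumes R: "Preorder R"
    and C: "cofinal_subset C R" "order_isomorphic P (Restr R C)"
    and D: "cofinal_subset D R" "order_isomorphic Q (Restr R D)"
  shows "cofinally_equiv P Q"
proof -
  have FC: "Field (Restr R C) = C" and FD: "Field (Restr R D) = D"
    using Field_Restr_Preorder R C(1) D(1) unfolding cofinal_subset_def by blast+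
  obtain f where f: "bij_betw f (Field P) C"
      "\<And>x y. x \<in> Field P \<Longrightarrow> y \<in> Field P \<Longrightarrow> (x, y) \<in> P \<longleftrightarrow> (f x, f y) \<in> R"
    using C(2) FC unfolding order_isomorphic_def bij_betw_def by fastforce
  obtain g where g: "bij_betw g (Field Q) D"
      "\<And>x y. x \<in> Field Q \<Longrightarrow> y \<in> Field Q \<Longrightarrow> (x, y) \<in> Q \<longleftrightarrow> (g x, g y) \<in> R"
    using D(2) FD unfolding order_isomorphic_def bij_betw_def by fastforce
  define e where "e = case_sum f g"
  define K where "K = Inl ` Field P \<union> Inr ` Field Q"
  define T where "T = {(x, y). x \<in> K \<and> y \<in> K \<and> (e x, e y) \<in> R}"
  have eK: "e x \<in> Field R" if "x \<in> K" for x
    using that f(1) g(1) C(1) D(1)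
    unfolding K_def e_def bij_betw_def cofinal_subset_def by auto
  have reflR: "\<And>x. x \<in> Field R \<Longrightarrow> (x, x) \<in> R" and transR: "trans R"
    using R unfolding preorder_on_def refl_on_def by auto
  have FT: "Field T = K"
    using eK reflR unfolding T_def Field_def by blast
  have T: "Preorder T"
    unfolding preorder_on_def FT
    using eK reflR transR unfolding T_def refl_on_def trans_def by blast
  have cofP: "cofinal_subset (Inl ` Field P) T"
  proof -
    have "\<exists>c\<in>Inl ` Field P. (x, c) \<in> T" if x: "x \<in> K" for x
    proof -
      obtain c where c: "c \<in> C" "(e x, c) \<in> R"
        using eK[OF x] C(1) unfolding cofinal_subset_def by blast
      then obtain p where "p \<in> Field P" "f p = c"
        using f(1) unfolding bij_betw_def by blast
      then have "(x, Inl p) \<in> T" using c x unfolding T_def K_def e_def by simp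
      then show ?thesis using \<open>p \<in> Field P\<close> by blast
    qed
    then show ?thesis unfolding cofinal_subset_def FT by (auto simp: K_def)
  qed
  have cofQ: "cofinal_subset (Inr ` Field Q) T"
  proof -
    have "\<exists>c\<in>Inr ` Field Q. (x, c) \<in> T" if x: "x \<in> K" for x
    proof -
      obtain c where c: "c \<in> D" "(e x, c) \<in> R"
        using eK[OF x] D(1) unfolding cofinal_subset_def by blast
      then obtain p where "p \<in> Field Q" "g p = c"
        using g(1) unfolding bij_betw_def by blast
      then have "(x, Inr p) \<in> T" using c x unfolding T_def K_def e_def by simp
      then show ?thesis using \<open>p \<in> Field Q\<close> by blast
    qed
    then show ?thesis unfolding cofinal_subset_def FT by (auto simp: K_def)
  qed
  have isoP: "order_isomorphic P (Restr T (Inl ` Field P))"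
  proof -
    have "Field (Restr T (Inl ` Field P)) = Inl ` Field P"
      by (rule Field_Restr_Preorder[OF T]) (auto simp: FT K_def)
    moreover have "bij_betw Inl (Field P) (Inl ` Field P)"
      by (simp add: bij_betw_def)
    ultimately show ?thesis unfolding order_isomorphic_def
      using f(2) by (intro exI[of _ Inl]) (auto simp: T_def K_def e_def)
  qed
  have isoQ: "order_isomorphic Q (Restr T (Inr ` Field Q))"
  proof -
    have "Field (Restr T (Inr ` Field Q)) = Inr ` Field Q"
      by (rule Field_Restr_Preorder[OF T]) (auto simp: FT K_def)
    moreover have "bij_betw Inr (Field Q) (Inr ` Field Q)"
      by (simp add: bij_betw_def)
    ultimately show ?thesis unfolding order_isomorphic_def
      using g(2) by (intro exI[of _ Inr]) (auto simp: T_def K_def e_def)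
  qed
  show ?thesis unfolding cofinally_equiv_def
    using T cofP cofQ isoP isoQ by blast
qed


section \<open>Cofinally scalene preorders\<close>

text \<open>The library's \<open>regularCard\<close> holds of every finite cardinal, so the finite case is
  restricted to \<open>1\<close> explicitly.\<close>

definition regular_cardinal :: "'k rel \<Rightarrow> bool" where
  "regular_cardinal r \<longleftrightarrow>
     Card_order r \<and> (infinite (Field r) \<and> regularCard r \<or> card (Field r) = 1)"

text \<open>A set \<open>S \<subseteq> Reg\<close> is a set of such relations, no two of which represent the same cardinal:
  without the second clause it would represent a multiset of cardinals.\<close>

definition set_of_regular_cardinals :: "'k rel set \<Rightarrow> bool" where
  "set_of_regular_cardinals S \<longleftrightarrow>
     (\<forall>r\<in>S. regular_cardinal r) \<and> (\<forall>r\<in>S. \<forall>s\<in>S. r =o s \<longrightarrow> r = s)"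

definition prod_order :: "'k rel set \<Rightarrow> ('k rel \<Rightarrow> 'k) rel" where
  "prod_order S =
     {(f, g). f \<in> Pi\<^sub>E S Field \<and> g \<in> Pi\<^sub>E S Field \<and> (\<forall>r\<in>S. (f r, g r) \<in> r)}"

text \<open>The type argument only bounds the size of the cardinals that can be represented. A
  statement about cofinally scalene preorders leaves it as a type variable, and so
  covers sets \<open>S\<close> of arbitrarily large cardinals.\<close>

definition cofinally_scalene :: "'k itself \<Rightarrow> 'a rel \<Rightarrow> bool" where
  "cofinally_scalene _ P \<longleftrightarrow>
     (\<exists>S :: 'k rel set. set_of_regular_cardinals S \<and> cofinally_equiv P (prod_order S))"


section \<open>The Stone-Cech remainder of the natural numbers\<close>

definition ultrafilter :: "'a filter \<Rightarrow> bool" where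
  "ultrafilter F \<longleftrightarrow>
     F \<noteq> bot \<and> (\<forall>A. eventually (\<lambda>x. x \<in> A) F \<or> eventually (\<lambda>x. x \<notin> A) F)"

text \<open>The points are the ultrafilters on the natural numbers, \<open>n\<close> being identified with the
  principal ultrafilter at \<open>n\<close>; the sets of all ultrafilters containing a given
  set form a base.\<close>

definition beta_omega :: "nat filter topology" where
  "beta_omega =
     topology_generated_by (range (\<lambda>A. {F. ultrafilter F \<and> eventually (\<lambda>n. n \<in> A) F}))"

definition beta_omega_remainder :: "nat filter topology" where
  "beta_omega_remainder =
     subtopology beta_omega (topspace beta_omega - range (\<lambda>n. principal {n}))"

lemma topspace_beta_omega: "topspace beta_omega = {F. ultrafilter F}"
proof -
  have "F \<in> topspace beta_omega" if "ultrafilter F" for F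
    unfolding beta_omega_def topology_generated_by_topspace
    using that by (intro UnionI[OF rangeI[of _ UNIV]]) simp
  moreover have "ultrafilter F" if "F \<in> topspace beta_omega" for F
    using that unfolding beta_omega_def topology_generated_by_topspace by auto
  ultimately show ?thesis by auto
qed

lemma topspace_beta_omega_remainder:
  "topspace beta_omega_remainder = {F. ultrafilter F \<and> (\<forall>n. F \<noteq> principal {n})}"
  unfolding beta_omega_remainder_def topspace_subtopology topspace_beta_omega by auto

definition neighborhoods :: "'a \<Rightarrow> 'a topology \<Rightarrow> 'a set set" where
  "neighborhoods p X = {U. U \<subseteq> topspace X \<and> p \<in> X interior_of U}"

definition nbhd_filter :: "'a \<Rightarrow> 'a topology \<Rightarrow> 'a set rel" where
  "nbhd_filter p X = {(U, V). U \<in> neighborhoods p X \<and> V \<in> neighborhoods p X \<and> U \<supseteq> V}"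


section \<open>Martin's axiom for $\sigma$-$n$-linked forcings\<close>

definition continuum :: "nat set rel" where
  "continuum = |UNIV :: nat set set|"

definition forcing :: "'p rel \<Rightarrow> bool" where
  "forcing P \<longleftrightarrow> Preorder P \<and> Field P \<noteq> {}"

text \<open>Repetitions among the \<open>n\<close> elements are allowed; this does not affect
  $\sigma$-$n$-linkedness, since a set with fewer than \<open>n\<close> elements is a finite union of singletons.\<close>

definition n_linked :: "'p rel \<Rightarrow> nat \<Rightarrow> 'p set \<Rightarrow> bool" where
  "n_linked P n A \<longleftrightarrow>
     (\<forall>f. (\<forall>i<n. f i \<in> A) \<longrightarrow> (\<exists>q\<in>Field P. \<forall>i<n. (q, f i) \<in> P))"

definition sigma_n_linked :: "'p rel \<Rightarrow> nat \<Rightarrow> bool" where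
  "sigma_n_linked P n \<longleftrightarrow>
     (\<exists>A :: nat \<Rightarrow> 'p set. Field P = (\<Union>k. A k) \<and> (\<forall>k. n_linked P n (A k)))"

definition dense_subset :: "'p rel \<Rightarrow> 'p set \<Rightarrow> bool" where
  "dense_subset P D \<longleftrightarrow> D \<subseteq> Field P \<and> (\<forall>p\<in>Field P. \<exists>d\<in>D. (d, p) \<in> P)"

definition forcing_filter :: "'p rel \<Rightarrow> 'p set \<Rightarrow> bool" where
  "forcing_filter P G \<longleftrightarrow>
     G \<subseteq> Field P \<and> G \<noteq> {} \<and>
     (\<forall>p\<in>G. \<forall>q. (p, q) \<in> P \<longrightarrow> q \<in> G) \<and>
     (\<forall>p\<in>G. \<forall>q\<in>G. \<exists>r\<in>G. (r, p) \<in> P \<and> (r, q) \<in> P)"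

definition MA_sigma_linked_on :: "'p itself \<Rightarrow> nat \<Rightarrow> bool" where
  "MA_sigma_linked_on _ n \<longleftrightarrow>
     (\<forall>(P :: 'p rel) \<D>.
        forcing P \<and> sigma_n_linked P n \<and> (\<forall>D\<in>\<D>. dense_subset P D) \<and> |\<D>| <o continuum
        \<longrightarrow> (\<exists>G. forcing_filter P G \<and> (\<forall>D\<in>\<D>. G \<inter> D \<noteq> {})))"

text \<open>MA asks for forcings of arbitrary size, but it is enough to quantify over those whose
  underlying set is contained in a type of size continuum: see
  \<open>MA_sigma_linked_any_type\<close> below.\<close>

definition MA_sigma_linked :: "nat \<Rightarrow> bool" where
  "MA_sigma_linked n \<longleftrightarrow> MA_sigma_linked_on TYPE(nat set) n"

context
begin

private definition small :: "'a set \<Rightarrow> bool" where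
  "small A \<longleftrightarrow> (\<exists>g :: nat set \<Rightarrow> 'a. A \<subseteq> range g)"

private lemma small_mono: "small B \<Longrightarrow> A \<subseteq> B \<Longrightarrow> small A"
  unfolding small_def by blast

private lemma small_singleton: "small {x}"
  unfolding small_def by (rule exI[of _ "\<lambda>_. x"]) auto

private lemma small_image: "small A \<Longrightarrow> small (h ` A)"
proof -
  assume "small A"
  then obtain g :: "nat set \<Rightarrow> _" where "A \<subseteq> range g" unfolding small_def by blast
  then have "h ` A \<subseteq> range (h \<circ> g)" by (auto simp: image_comp[symmetric])
  then show ?thesis unfolding small_def by blast
qed

private lemma small_seq: "small A \<Longrightarrow> small {f :: nat \<Rightarrow> 'a. range f \<subseteq> A}"
proof -
  assume "small A"
  then obtain g :: "nat set \<Rightarrow> 'a" where g: "A \<subseteq> range g" unfolding small_def by blast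
  have "{f :: nat \<Rightarrow> 'a. range f \<subseteq> A} \<subseteq> range (\<lambda>X i. g {j. prod_encode (i, j) \<in> X})"
  proof
    fix f :: "nat \<Rightarrow> 'a" assume "f \<in> {f. range f \<subseteq> A}"
    then have "\<forall>i. \<exists>Y. f i = g Y" using g by (auto simp: image_def subset_iff)
    then obtain Y where Y: "\<And>i. f i = g (Y i)" by metis
    define X where "X = {m. case prod_decode m of (i, j) \<Rightarrow> j \<in> Y i}"
    have "{j. prod_encode (i, j) \<in> X} = Y i" for i unfolding X_def by auto
    then have "f = (\<lambda>i. g {j. prod_encode (i, j) \<in> X})" using Y by auto
    then show "f \<in> range (\<lambda>X i. g {j. prod_encode (i, j) \<in> X})" by blast
  qed
  then show ?thesis unfolding small_def by blast
qed

private lemma small_UN: "(\<And>i. small (A i)) \<Longrightarrow> small (\<Union>i::nat. A i)"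
proof -
  assume "\<And>i. small (A i)"
  then have "\<forall>i. \<exists>g :: nat set \<Rightarrow> 'a. A i \<subseteq> range g" unfolding small_def by blast
  then obtain g :: "nat \<Rightarrow> nat set \<Rightarrow> 'a" where g: "\<And>i. A i \<subseteq> range (g i)" by metis
  let ?h = "\<lambda>X. g (LEAST i. prod_encode (0, i) \<in> X) {j. prod_encode (1, j) \<in> X}"
  have "(\<Union>i. A i) \<subseteq> range ?h"
  proof
    fix x assume "x \<in> (\<Union>i. A i)"
    then obtain i Y where x: "x = g i Y" using g by blast
    define X where "X = {prod_encode (0, i)} \<union> (\<lambda>j. prod_encode (1, j)) ` Y"
    have "(LEAST k. prod_encode (0, k) \<in> X) = i"
      unfolding X_def by (rule Least_equality) auto
    moreover have "{j. prod_encode (1, j) \<in> X} = Y" unfolding X_def by auto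
    ultimately show "x \<in> range ?h" using x by blast
  qed
  then show ?thesis unfolding small_def by blast
qed

private lemma small_Un: "small A \<Longrightarrow> small B \<Longrightarrow> small (A \<union> B)"
proof -
  assume "small A" "small B"
  then have "small (\<Union>i::nat. if i = 0 then A else B)" by (intro small_UN) auto
  moreover have "A \<subseteq> (\<Union>i::nat. if i = 0 then A else B)"
    using UN_upper[of 0 UNIV "\<lambda>i::nat. if i = 0 then A else B"] by simp
  moreover have "B \<subseteq> (\<Union>i::nat. if i = 0 then A else B)"
    using UN_upper[of 1 UNIV "\<lambda>i::nat. if i = 0 then A else B"] by simp
  ultimately show ?thesis by (blast intro: small_mono)
qed

private lemma small_image2:
  "small A \<Longrightarrow> small B \<Longrightarrow> small {h x y |x y. x \<in> A \<and> y \<in> B}"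
proof -
  assume "small A" "small B"
  then obtain g k where g: "A \<subseteq> range (g :: nat set \<Rightarrow> _)" "B \<subseteq> range (k :: nat set \<Rightarrow> _)"
    unfolding small_def by blast
  have "small (range (id :: nat set \<Rightarrow> nat set))" unfolding small_def by blast
  then have "small {f :: nat \<Rightarrow> nat set. range f \<subseteq> UNIV}" by (intro small_seq) simp
  then have "small ((\<lambda>f. h (g (f 0)) (k (f 1))) ` {f :: nat \<Rightarrow> nat set. range f \<subseteq> UNIV})"
    by (rule small_image)
  moreover have "{h x y |x y. x \<in> A \<and> y \<in> B} \<subseteq>
      (\<lambda>f. h (g (f 0)) (k (f 1))) ` {f :: nat \<Rightarrow> nat set. range f \<subseteq> UNIV}"
  proof
    fix z assume "z \<in> {h x y |x y. x \<in> A \<and> y \<in> B}"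
    then obtain X Y where "z = h (g X) (k Y)" using g by blast
    then show "z \<in> (\<lambda>f. h (g (f 0)) (k (f 1))) ` {f :: nat \<Rightarrow> nat set. range f \<subseteq> UNIV}"
      by (intro image_eqI[of _ _ "\<lambda>i. if i = 0 then X else Y"]) simp_all
  qed
  ultimately show ?thesis by (rule small_mono)
qed

lemma MA_sigma_linked_any_type:
  assumes MA: "MA_sigma_linked n"
  shows "MA_sigma_linked_on TYPE('p) n"
  unfolding MA_sigma_linked_on_def
proof (intro allI impI, elim conjE)
  fix P :: "'p rel" and \<D>
  assume P: "forcing P" and lk: "sigma_n_linked P n"
    and dn: "\<forall>D\<in>\<D>. dense_subset P D" and card: "|\<D>| <o continuum"
  have reflP: "\<And>x. x \<in> Field P \<Longrightarrow> (x, x) \<in> P" and transP: "trans P" and neP: "Field P \<noteq> {}"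
    using P unfolding forcing_def preorder_on_def refl_on_def by auto
  obtain p0 where p0: "p0 \<in> Field P" using neP by blast
  obtain A :: "nat \<Rightarrow> 'p set" where A: "Field P = (\<Union>k. A k)" "\<And>k. n_linked P n (A k)"
    using lk unfolding sigma_n_linked_def by blast
  have smallD: "small \<D>"
  proof -
    have "|\<D>| \<le>o |UNIV :: nat set set|"
      using card unfolding continuum_def by (rule ordLess_imp_ordLeq)
    then obtain f :: "'p set \<Rightarrow> nat set" where "inj_on f \<D>"
      using card_of_ordLeq[of \<D> "UNIV :: nat set set"] by blast
    then have "\<D> \<subseteq> range (inv_into \<D> f)" by (metis image_eqI inv_into_f_f subsetI UNIV_I)
    then show ?thesis unfolding small_def by blast
  qed
  define w where "w D x = (SOME d. d \<in> D \<and> (d, x) \<in> P)" for D x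
  define b where "b f = (if \<exists>q\<in>Field P. \<forall>i<n. (q, f i) \<in> P
      then SOME q. q \<in> Field P \<and> (\<forall>i<n. (q, f i) \<in> P) else p0)" for f :: "nat \<Rightarrow> 'p"
  have w: "w D x \<in> D \<and> (w D x, x) \<in> P" if "D \<in> \<D>" "x \<in> Field P" for D x
  proof -
    have "\<exists>d. d \<in> D \<and> (d, x) \<in> P" using dn that unfolding dense_subset_def by blast
    then show ?thesis unfolding w_def by (rule someI_ex)
  qed
  have b1: "b f \<in> Field P \<and> (\<forall>i<n. (b f, f i) \<in> P)" if "\<exists>q\<in>Field P. \<forall>i<n. (q, f i) \<in> P" for f
  proof -
    have "\<exists>q. q \<in> Field P \<and> (\<forall>i<n. (q, f i) \<in> P)" using that by blast
    from someI_ex[OF this] show ?thesis unfolding b_def using that by simp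
  qed
  have b2: "b f \<in> Field P" for f
    using b1[of f] p0 by (cases "\<exists>q\<in>Field P. \<forall>i<n. (q, f i) \<in> P") (auto simp: b_def)
  define step where
    "step X = X \<union> {w D x |D x. D \<in> \<D> \<and> x \<in> X} \<union> b ` {f. range f \<subseteq> X}" for X
  define M where "M k = (step ^^ k) {p0}" for k
  have M0: "M 0 = {p0}" and MS: "M (Suc k) = step (M k)" for k by (auto simp: M_def)
  have Mmono: "k \<le> l \<Longrightarrow> M k \<subseteq> M l" for k l
    by (rule lift_Suc_mono_le[of M]) (auto simp: MS step_def)
  have Msmall: "small (M k)" for k
    by (induction k) (auto simp: M0 MS step_def
        intro!: small_singleton small_Un small_image2 small_image small_seq smallD)
  have MF: "M k \<subseteq> Field P" for k
  proof (induction k)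
    case 0 then show ?case using p0 by (simp add: M0)
  next
    case (Suc k)
    have "w D x \<in> Field P" if "D \<in> \<D>" "x \<in> M k" for D x
      using w[of D x] that Suc by (auto simp: Field_def)
    then show ?case using Suc b2 by (auto simp: MS step_def)
  qed
  define N where "N = (\<Union>k. M k)"
  have NF: "N \<subseteq> Field P" using MF by (auto simp: N_def)
  have p0N: "p0 \<in> N" unfolding N_def using M0 by blast
  have wN: "w D x \<in> N" if D: "D \<in> \<D>" and x: "x \<in> N" for D x
  proof -
    obtain k where "x \<in> M k" using x by (auto simp: N_def)
    then have "w D x \<in> M (Suc k)" using D by (auto simp: MS step_def)
    then show ?thesis by (auto simp: N_def)
  qed
  have bN: "\<exists>q\<in>N. \<forall>i<n. (q, f i) \<in> P"
    if f: "\<And>i. i < n \<Longrightarrow> f i \<in> N" and ex: "\<exists>q\<in>Field P. \<forall>i<n. (q, f i) \<in> P" for f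
  proof -
    have "\<forall>i. \<exists>k. i < n \<longrightarrow> f i \<in> M k" using f by (auto simp: N_def)
    then obtain k where k: "\<And>i. i < n \<Longrightarrow> f i \<in> M (k i)" by metis
    define l where "l = (\<Sum>i<n. k i)"
    define f' where "f' i = (if i < n then f i else p0)" for i
    have f': "f' i = f i" if "i < n" for i using that by (simp add: f'_def)
    have "f i \<in> M l" if "i < n" for i
    proof -
      have "k i \<le> l" unfolding l_def using that by (intro member_le_sum) auto
      then show ?thesis using k[OF that] Mmono by blast
    qed
    moreover have "p0 \<in> M l" using Mmono[of 0 l] M0 by auto
    ultimately have "range f' \<subseteq> M l" by (auto simp: f'_def)
    then have "b f' \<in> M (Suc l)" by (auto simp: MS step_def)
    then have 1: "b f' \<in> N" by (auto simp: N_def)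
    have "\<exists>q\<in>Field P. \<forall>i<n. (q, f' i) \<in> P" using ex f' by auto
    from b1[OF this] have "\<forall>i<n. (b f', f i) \<in> P" using f' by auto
    with 1 show ?thesis by blast
  qed
  have "small N" unfolding N_def by (rule small_UN) (rule Msmall)
  then obtain g :: "nat set \<Rightarrow> 'p" where g: "N \<subseteq> range g" unfolding small_def by blast
  define h where "h x = inv g x" for x
  have gh: "g (h x) = x" if "x \<in> N" for x
    unfolding h_def using g that by (meson f_inv_into_f subsetD)
  define Q where "Q = {(h x, h y) |x y. x \<in> N \<and> y \<in> N \<and> (x, y) \<in> P}"
  have QI: "(h x, h y) \<in> Q \<longleftrightarrow> (x, y) \<in> P" if "x \<in> N" "y \<in> N" for x y
  proof
    assume "(h x, h y) \<in> Q"
    then obtain x' y' where "h x = h x'" "h y = h y'" "x' \<in> N" "y' \<in> N" "(x', y') \<in> P"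
      unfolding Q_def by blast
    then show "(x, y) \<in> P" using gh that by metis
  qed (use that in \<open>auto simp: Q_def\<close>)
  have QN: "\<exists>x'\<in>N. \<exists>y'\<in>N. x = h x' \<and> y = h y' \<and> (x', y') \<in> P" if "(x, y) \<in> Q" for x y
    using that unfolding Q_def by blast
  have reflN: "(x, x) \<in> P" if "x \<in> N" for x
    using that NF reflP by blast
  have FQ: "Field Q = h ` N"
  proof
    show "Field Q \<subseteq> h ` N" unfolding Field_def using QN by blast
    show "h ` N \<subseteq> Field Q"
    proof (rule image_subsetI)
      fix x assume "x \<in> N"
      then have "(h x, h x) \<in> Q" using QI reflN by simp
      then show "h x \<in> Field Q" by (rule FieldI1)
    qed
  qed
  have forcQ: "forcing Q"
    unfolding forcing_def preorder_on_def
  proof (intro conjI)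
    show "Q \<subseteq> Field Q \<times> Field Q" by (auto simp: Field_def)
    show "refl_on (Field Q) Q" unfolding refl_on_def FQ using QI reflN by auto
    show "trans Q"
    proof (rule transI)
      fix x y z assume xy: "(x, y) \<in> Q" and yz: "(y, z) \<in> Q"
      obtain x' y' where 1: "x' \<in> N" "y' \<in> N" "x = h x'" "y = h y'" "(x', y') \<in> P"
        using QN[OF xy] by blast
      obtain z' where 2: "z' \<in> N" "z = h z'" using QN[OF yz] by blast
      have "(y', z') \<in> P" using yz 1 2 QI by simp
      then have "(x', z') \<in> P" using 1(5) transP by (blast dest: transD)
      then show "(x, z) \<in> Q" using 1 2 QI by simp
    qed
    show "Field Q \<noteq> {}" using p0N FQ by blast
  qed
  have linkQ: "sigma_n_linked Q n"
    unfolding sigma_n_linked_def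
  proof (intro exI[of _ "\<lambda>k. h ` (A k \<inter> N)"] conjI allI)
    show "Field Q = (\<Union>k. h ` (A k \<inter> N))" unfolding FQ using NF A(1) by (simp flip: image_UN Int_UN_distrib2 add: Int_absorb1)
    fix k show "n_linked Q n (h ` (A k \<inter> N))"
      unfolding n_linked_def
    proof (intro allI impI)
      fix f assume f: "\<forall>i<n. f i \<in> h ` (A k \<inter> N)"
      have gf: "g (f i) \<in> A k \<inter> N \<and> h (g (f i)) = f i" if "i < n" for i
        using f that gh by fastforce
      have "\<exists>q\<in>Field P. \<forall>i<n. (q, g (f i)) \<in> P"
        using A(2)[of k] gf unfolding n_linked_def by (elim allE[of _ "\<lambda>i. g (f i)"]) blast
      then obtain q where "q \<in> N" "\<forall>i<n. (q, g (f i)) \<in> P"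
        using bN[of "\<lambda>i. g (f i)"] gf by blast
      then have "h q \<in> Field Q \<and> (\<forall>i<n. (h q, f i) \<in> Q)"
        using gf QI[of q "g (f _)"] FQ by force
      then show "\<exists>q\<in>Field Q. \<forall>i<n. (q, f i) \<in> Q" by blast
    qed
  qed
  define \<E> where "\<E> = (\<lambda>D. h ` (D \<inter> N)) ` \<D>"
  have denseQ: "\<forall>E\<in>\<E>. dense_subset Q E"
  proof
    fix E assume "E \<in> \<E>"
    then obtain D where D: "D \<in> \<D>" "E = h ` (D \<inter> N)" unfolding \<E>_def by blast
    have "\<exists>d\<in>E. (d, h x) \<in> Q" if x: "x \<in> N" for x
    proof -
      have "w D x \<in> D \<inter> N" "(w D x, x) \<in> P" using w[of D x] wN[of D x] D x NF by auto
      then have "(h (w D x), h x) \<in> Q" "h (w D x) \<in> E" using D(2) QI x by auto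
      then show ?thesis by blast
    qed
    then show "dense_subset Q E" unfolding dense_subset_def FQ using D(2) by auto
  qed
  have "|\<E>| <o continuum"
    unfolding \<E>_def by (rule ordLeq_ordLess_trans[OF card_of_image card])
  with forcQ linkQ denseQ
  have "\<exists>G. forcing_filter Q G \<and> (\<forall>E\<in>\<E>. G \<inter> E \<noteq> {})"
    by (intro MA[unfolded MA_sigma_linked_def MA_sigma_linked_on_def, THEN spec, THEN spec,
          THEN mp] conjI)
  then obtain G where G: "forcing_filter Q G" "\<forall>E\<in>\<E>. G \<inter> E \<noteq> {}" by blast
  define H where "H = {x \<in> Field P. \<exists>y\<in>N. h y \<in> G \<and> (y, x) \<in> P}"
  have GF: "G \<subseteq> h ` N" and Gne: "G \<noteq> {}"
    and Gdir: "\<forall>p\<in>G. \<forall>q\<in>G. \<exists>r\<in>G. (r, p) \<in> Q \<and> (r, q) \<in> Q"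
    using G(1) FQ unfolding forcing_filter_def by simp_all
  have GN: "\<exists>y\<in>N. q = h y" if "q \<in> G" for q
    using GF that by auto
  have "forcing_filter P H"
    unfolding forcing_filter_def
  proof (intro conjI ballI allI impI)
    show "H \<subseteq> Field P" by (auto simp: H_def)
    obtain q where "q \<in> G" using Gne by blast
    then obtain y where "y \<in> N" "h y \<in> G" using GN[of q] by auto
    then have "y \<in> H" unfolding H_def using NF reflN by auto
    then show "H \<noteq> {}" by blast
  next
    fix p q assume "p \<in> H" "(p, q) \<in> P"
    then show "q \<in> H" unfolding H_def using transP by (auto intro: FieldI2 dest: transD)
  next
    fix p q assume "p \<in> H" "q \<in> H"
    then obtain y z where yz: "y \<in> N" "h y \<in> G" "(y, p) \<in> P" "z \<in> N" "h z \<in> G" "(z, q) \<in> P"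
      unfolding H_def by blast
    then obtain r' where r': "r' \<in> G" "(r', h y) \<in> Q" "(r', h z) \<in> Q"
      using Gdir[rule_format, OF yz(2) yz(5)] by auto
    obtain r where r: "r \<in> N" "r' = h r" using GN[OF r'(1)] by auto
    then have "(r, y) \<in> P" "(r, z) \<in> P" using r' QI yz by auto
    then have "(r, p) \<in> P" "(r, q) \<in> P" using yz transP by (auto dest: transD)
    moreover have "r \<in> H" unfolding H_def using r r'(1) NF reflN by auto
    ultimately show "\<exists>r\<in>H. (r, p) \<in> P \<and> (r, q) \<in> P" by blast
  qed
  moreover have "H \<inter> D \<noteq> {}" if D: "D \<in> \<D>" for D
  proof -
    have "G \<inter> h ` (D \<inter> N) \<noteq> {}" using G(2) D unfolding \<E>_def by blast
    then obtain x where "x \<in> D" "x \<in> N" "h x \<in> G" by blast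
    then have "x \<in> H" unfolding H_def using NF reflN by auto
    then show ?thesis using \<open>x \<in> D\<close> by blast
  qed
  ultimately show "\<exists>G. forcing_filter P G \<and> (\<forall>D\<in>\<D>. G \<inter> D \<noteq> {})" by blast
qed

end

end

theory Submission
  imports Defs
begin

text \<open>
  Let \<open>p\<close> be a point of the remainder whose neighbourhood filter is cofinally equivalent to
  \<open>\<Prod>S\<close>. Since \<open>p\<close> is not isolated, \<open>S\<close> has an infinite member (\<open>greatest_if_no_infinite_factor\<close>,
  \<open>nbhd_filter_no_greatest\<close>). Since \<open>p\<close> has a neighbourhood base of size at most the continuum,
  every infinite member of \<open>S\<close> is at most the continuum (\<open>factor_le_continuum\<close>). If the least
  infinite member \<open>\<kappa>\<close> of \<open>S\<close> is not smaller than the continuum, then up to a trivial factor \<open>S\<close>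
  is the singleton of the continuum, and the theorem follows.

  It remains to show that \<open>\<kappa>\<close> cannot be smaller than the continuum (\<open>least_factor_ge_continuum\<close>).
  Identify neighbourhoods with members of the ultrafilter \<open>p\<close> ordered by inclusion modulo finite sets. As \<open>\<kappa>\<close> is the least infinite
  factor, fewer than \<open>\<kappa>\<close> members of \<open>p\<close> always have a pseudo-intersection in \<open>p\<close>
  (\<open>directed_below_least\<close>), while \<open>p\<close> is the union of an increasing chain of \<open>\<kappa>\<close> filters
  \<open>N\<^sub>a \<noteq> p\<close> (\<open>filtration_below_least\<close>). A recursion of length \<open>\<kappa>\<close> then produces almost disjoint
  sets \<open>D\<^sub>b\<close> with complement in \<open>p\<close> but not in \<open>N\<^sub>b\<close>. In particular, for no cofinal set of indices
  \<open>b\<close> are the sets \<open>D\<^sub>b\<close> almost disjoint from a single member of \<open>p\<close>.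

  Split the indices into \<open>n + 1\<close> cofinal classes. A forcing with finite conditions adds a partition
  of \<open>\<omega>\<close> into \<open>n + 1\<close> pieces, the \<open>i\<close>-th of which is almost disjoint from all \<open>D\<^sub>b\<close> with \<open>b\<close> in
  the \<open>i\<close>-th class (\<open>separating_colouring\<close>). A condition with stem \<open>f\<close> excludes at most one piece for each
  number beyond \<open>f\<close>, so \<open>n\<close> conditions with the same stem always leave one of the \<open>n + 1\<close> pieces, and
  the forcing is $\sigma$-$n$-linked. If \<open>\<kappa>\<close> were smaller than the continuum, Martin's axiom
  would yield such a partition. One of its pieces would belong to the ultrafilter \<open>p\<close>, which contradicts the previous paragraph.
\<close>

section \<open>Ultrafilters and neighbourhoods in the remainder\<close>

text \<open>Zorn's lemma, applied to the proper filters below \<open>F\<close>: a minimal one \<open>U\<close> decides every set \<open>A\<close>,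
  since otherwise adding \<open>A\<close> to \<open>U\<close> would give a smaller proper filter.\<close>

lemma ultrafilter_below:
  assumes "F \<noteq> bot"
  shows "\<exists>U. ultrafilter U \<and> U \<le> F"
proof -
  define X where "X = {G. G \<noteq> bot \<and> G \<le> F}"
  define r where "r = relation_of (\<lambda>G H :: 'a filter. H \<le> G) X"
  have po: "partial_order_on X r"
    unfolding r_def by (rule partial_order_on_relation_ofI) auto
  have ub: "\<exists>u\<in>X. \<forall>G\<in>C. u \<le> G" if C: "C \<in> Chains r" for C
  proof (cases "C = {}")
    case True
    then show ?thesis using assms by (auto simp: X_def)
  next
    case False
    have CX: "C \<subseteq> X" and lin: "G \<le> H \<or> H \<le> G" if "G \<in> C" "H \<in> C" for G H
      using C that unfolding Chains_def r_def relation_of_def by auto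
    have base: "eventually P (Inf C) \<longleftrightarrow> (\<exists>G\<in>C. eventually P G)" for P
    proof (rule eventually_Inf_base[OF False])
      fix G H assume "G \<in> C" "H \<in> C"
      then show "\<exists>x\<in>C. x \<le> inf G H" using lin[of G H] by (metis inf.absorb1 inf.absorb2 order_refl)
    qed
    have "G \<noteq> bot" if "G \<in> C" for G using CX[OF that that] that by (auto simp: X_def)
    then have "Inf C \<noteq> bot" using base[of "\<lambda>_. False"] by (auto simp: trivial_limit_def)
    moreover have "Inf C \<le> F"
    proof -
      obtain G where G: "G \<in> C" using False by blast
      then have "G \<le> F" using CX[OF G G] by (auto simp: X_def)
      then show ?thesis using Inf_lower[OF G] by (rule order_trans[rotated])
    qed
    ultimately have "Inf C \<in> X" by (simp add: X_def)
    then show ?thesis using Inf_lower[of _ C] by blast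
  qed
  obtain U where U: "U \<in> X" and min: "\<And>G. G \<in> X \<Longrightarrow> G \<le> U \<Longrightarrow> G = U"
  proof -
    have "\<exists>m\<in>X. \<forall>a\<in>X. a \<le> m \<longrightarrow> a = m"
      by (rule predicate_Zorn[OF po[unfolded r_def]]) (rule ub[unfolded r_def])
    then show thesis using that by blast
  qed
  have "eventually (\<lambda>x. x \<in> A) U \<or> eventually (\<lambda>x. x \<notin> A) U" for A
  proof (cases "inf U (principal A) = bot")
    case True
    then show ?thesis by (simp add: trivial_limit_def eventually_inf_principal)
  next
    case False
    moreover have "inf U (principal A) \<le> F" using U by (auto simp: X_def intro: le_infI1)
    ultimately have "inf U (principal A) = U" by (intro min) (auto simp: X_def)
    moreover have "eventually (\<lambda>x. x \<in> A) (inf U (principal A))"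
      by (simp add: eventually_inf_principal)
    ultimately show ?thesis by simp
  qed
  then show ?thesis using U unfolding ultrafilter_def X_def by blast
qed

lemma nonprincipal_ultrafilter_cofinite:
  assumes p: "p \<in> topspace beta_omega_remainder" and A: "finite A"
  shows "eventually (\<lambda>n. n \<notin> A) p"
proof -
  have "eventually (\<lambda>n. n \<noteq> m) p" for m
  proof (rule ccontr)
    assume "\<not> eventually (\<lambda>n. n \<noteq> m) p"
    then have "eventually (\<lambda>n. n \<in> {m}) p"
      using p unfolding topspace_beta_omega_remainder ultrafilter_def
      by (auto elim: allE[of _ "{m}"])
    then have le: "p \<le> principal {m}" by (simp add: le_principal)
    have "eventually P (principal {m})" if P: "eventually P p" for P
    proof (rule ccontr)
      assume "\<not> eventually P (principal {m})"
      then have "\<not> P m" by (simp add: eventually_principal)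
      from P \<open>eventually (\<lambda>n. n \<in> {m}) p\<close> have "eventually (\<lambda>n. False) p"
        by eventually_elim (use \<open>\<not> P m\<close> in auto)
      then show False using p unfolding topspace_beta_omega_remainder ultrafilter_def by auto
    qed
    then have "principal {m} \<le> p" by (simp add: le_filter_def)
    with le show False using p unfolding topspace_beta_omega_remainder by auto
  qed
  then have "eventually (\<lambda>n. \<forall>m\<in>A. n \<noteq> m) p"
    using A by (intro eventually_ball_finite) auto
  then show ?thesis by eventually_elim auto
qed

lemma infinite_set_in_remainder_point:
  assumes "infinite A"
  shows "\<exists>p\<in>topspace beta_omega_remainder. eventually (\<lambda>n. n \<in> A) p"
proof -
  define F where "F = inf cofinite (principal A)"
  have "F \<noteq> bot"
    using assms unfolding F_def trivial_limit_def eventually_inf_principal eventually_cofinite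
    by simp
  then obtain U where U: "ultrafilter U" "U \<le> F" using ultrafilter_below by blast
  have ev: "eventually P U" if "eventually P F" for P using U(2) that by (rule filter_leD)
  have "eventually (\<lambda>n. n \<in> A) U" by (rule ev) (simp add: F_def eventually_inf_principal)
  moreover have "U \<noteq> principal {m}" for m
  proof
    assume "U = principal {m}"
    moreover have "eventually (\<lambda>n. n \<noteq> m) U"
      by (rule ev) (simp add: F_def eventually_inf_principal eventually_cofinite)
    ultimately show False by (simp add: eventually_principal)
  qed
  ultimately show ?thesis using U(1) unfolding topspace_beta_omega_remainder by blast
qed

text \<open>The clopen set usually written \<open>A\<^sup>*\<close>. These sets turn neighbourhoods in the remainder into subsets
  of \<open>\<omega>\<close> ordered by inclusion modulo finite sets.\<close>

definition star :: "nat set \<Rightarrow> nat filter set" where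
  "star A = {q \<in> topspace beta_omega_remainder. eventually (\<lambda>n. n \<in> A) q}"

text \<open>If \<open>A - B\<close> is infinite, a nonprincipal ultrafilter containing it separates the two sets; if it is
  finite, no nonprincipal ultrafilter notices it.\<close>

lemma star_subset_iff: "star A \<subseteq> star B \<longleftrightarrow> finite (A - B)"
proof
  assume sub: "star A \<subseteq> star B"
  show "finite (A - B)"
  proof (rule ccontr)
    assume "infinite (A - B)"
    then obtain q where q: "q \<in> topspace beta_omega_remainder" "eventually (\<lambda>n. n \<in> A - B) q"
      using infinite_set_in_remainder_point by blast
    have "q \<in> star A" unfolding star_def using q by (auto elim: eventually_mono)
    then have "eventually (\<lambda>n. n \<in> B) q" using sub unfolding star_def by blast
    with q(2) have "eventually (\<lambda>n. False) q" by eventually_elim auto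
    then show False using q(1) unfolding topspace_beta_omega_remainder ultrafilter_def by auto
  qed
next
  assume fin: "finite (A - B)"
  show "star A \<subseteq> star B"
  proof
    fix q assume "q \<in> star A"
    then have q: "q \<in> topspace beta_omega_remainder" "eventually (\<lambda>n. n \<in> A) q"
      unfolding star_def by auto
    from q(2) nonprincipal_ultrafilter_cofinite[OF q(1) fin] have "eventually (\<lambda>n. n \<in> B) q"
      by eventually_elim auto
    then show "q \<in> star B" using q(1) unfolding star_def by blast
  qed
qed

lemma star_Int: "star (A \<inter> B) = star A \<inter> star B"
  unfolding star_def by (auto simp: eventually_conj_iff)

lemma openin_star: "openin beta_omega_remainder (star A)"
proof -
  let ?B = "{F. ultrafilter F \<and> eventually (\<lambda>n. n \<in> A) F}"
  have "openin beta_omega ?B"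
    unfolding beta_omega_def by (rule topology_generated_by_Basis) blast
  moreover have "star A = ?B \<inter> (topspace beta_omega - range (\<lambda>n. principal {n}))"
    unfolding star_def topspace_beta_omega_remainder topspace_beta_omega by auto
  ultimately show ?thesis
    unfolding beta_omega_remainder_def openin_subtopology by blast
qed

lemma star_neighborhood:
  assumes "p \<in> topspace beta_omega_remainder" "eventually (\<lambda>n. n \<in> A) p"
  shows "star A \<in> neighborhoods p beta_omega_remainder"
  using assms openin_star[of A] interior_of_openin[OF openin_star[of A]]
  unfolding neighborhoods_def star_def by auto

lemma openin_beta_omega_base:
  assumes "openin beta_omega U" "p \<in> U"
  shows "\<exists>A. eventually (\<lambda>n. n \<in> A) p \<and>
             {F. ultrafilter F \<and> eventually (\<lambda>n. n \<in> A) F} \<subseteq> U"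
proof -
  have "generate_topology_on (range (\<lambda>A. {F. ultrafilter F \<and> eventually (\<lambda>n. n \<in> A) F})) U"
    using assms(1) unfolding beta_omega_def openin_topology_generated_by_iff .
  then show ?thesis using assms(2)
  proof induction
    case Empty
    then show ?case by simp
  next
    case (Int U V)
    then obtain A B where AB: "eventually (\<lambda>n. n \<in> A) p" "eventually (\<lambda>n. n \<in> B) p"
      "{F. ultrafilter F \<and> eventually (\<lambda>n. n \<in> A) F} \<subseteq> U"
      "{F. ultrafilter F \<and> eventually (\<lambda>n. n \<in> B) F} \<subseteq> V" by auto
    then have "eventually (\<lambda>n. n \<in> A \<inter> B) p" by (simp add: eventually_conj_iff)
    moreover have "{F. ultrafilter F \<and> eventually (\<lambda>n. n \<in> A \<inter> B) F} \<subseteq> U \<inter> V"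
      using AB(3,4) by (auto simp: eventually_conj_iff)
    ultimately show ?case by blast
  next
    case (UN K)
    then show ?case by blast
  next
    case (Basis s)
    then show ?case by blast
  qed
qed

lemma neighborhood_contains_star:
  assumes U: "U \<in> neighborhoods p beta_omega_remainder"
  shows "\<exists>A. eventually (\<lambda>n. n \<in> A) p \<and> star A \<subseteq> U"
proof -
  obtain V where V: "openin beta_omega_remainder V" "p \<in> V" "V \<subseteq> U"
    using U unfolding neighborhoods_def interior_of_def by auto
  then obtain W where W: "openin beta_omega W"
    "V = W \<inter> (topspace beta_omega - range (\<lambda>n. principal {n}))"
    unfolding beta_omega_remainder_def openin_subtopology by blast
  obtain A where A: "eventually (\<lambda>n. n \<in> A) p"
      "{F. ultrafilter F \<and> eventually (\<lambda>n. n \<in> A) F} \<subseteq> W"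
    using openin_beta_omega_base[OF W(1)] V(2) W(2) by blast
  have "star A \<subseteq> V"
    using A(2) W(2) unfolding star_def topspace_beta_omega_remainder topspace_beta_omega by auto
  then show ?thesis using A(1) V(3) by blast
qed

lemma Field_nbhd_filter: "Field (nbhd_filter p X) = neighborhoods p X"
  unfolding nbhd_filter_def Field_def by auto

text \<open>The remainder has no isolated points: a member of \<open>p\<close> splits into two infinite halves, and \<open>p\<close>
  contains a set that misses one of them.\<close>

lemma nbhd_filter_no_greatest:
  assumes p: "p \<in> topspace beta_omega_remainder"
    and W: "W \<in> neighborhoods p beta_omega_remainder"
  shows "\<exists>U\<in>neighborhoods p beta_omega_remainder. \<not> W \<subseteq> U"
proof -
  obtain A where A: "eventually (\<lambda>n. n \<in> A) p" "star A \<subseteq> W"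
    using neighborhood_contains_star[OF W] by blast
  have "infinite A"
  proof
    assume "finite A"
    from A(1) nonprincipal_ultrafilter_cofinite[OF p this] have "eventually (\<lambda>n. False) p"
      by eventually_elim auto
    then show False using p unfolding topspace_beta_omega_remainder ultrafilter_def by auto
  qed
  then obtain B C where BC: "B \<subseteq> A" "C \<subseteq> A" "infinite B" "infinite C" "B \<inter> C = {}"
    by (rule infinite_split)
  have "\<exists>D. eventually (\<lambda>n. n \<in> D) p \<and> infinite (A - D)"
  proof (cases "eventually (\<lambda>n. n \<in> B) p")
    case True
    have "C \<subseteq> A - B" using BC by blast
    from infinite_super[OF this BC(4)] True show ?thesis by blast
  next
    case False
    then have "eventually (\<lambda>n. n \<in> - B) p"
      using p unfolding topspace_beta_omega_remainder ultrafilter_def by auto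
    moreover have "B \<subseteq> A - - B" using BC by blast
    ultimately show ?thesis using infinite_super[OF _ BC(3)] by blast
  qed
  then obtain D where D: "eventually (\<lambda>n. n \<in> D) p" "infinite (A - D)" by blast
  then have "\<not> W \<subseteq> star D" using A(2) star_subset_iff[of A D] by blast
  then show ?thesis using star_neighborhood[OF p D(1)] by blast
qed


section \<open>A forcing that separates orthogonal families\<close>

text \<open>The sets \<open>D b\<close> with \<open>b\<close> of one colour \<open>i\<close> form a family, and families of different colours are
  orthogonal modulo finite. The forcing adds a function \<open>c\<close> with values in \<open>{0,\<dots>,n}\<close> such that
  the class \<open>c\<^sup>-\<^sup>1(i)\<close> is almost disjoint from every set of the family of colour \<open>i\<close>. For two families
  this is an ordinary separation, which can fail, as the gaps of Hausdorff and Luzin show. With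
  \<open>n + 1\<close> colours the forcing is $\sigma$-$n$-linked for a counting reason: \<open>n\<close> conditions exclude at most
  \<open>n\<close> values at each place.\<close>

locale orthogonal_families =
  fixes n :: nat and I :: "'i set" and D :: "'i \<Rightarrow> nat set" and col :: "'i \<Rightarrow> nat"
  assumes n_pos: "n \<ge> 1"
    and orthogonal: "\<And>b c. b \<in> I \<Longrightarrow> c \<in> I \<Longrightarrow> col b \<noteq> col c \<Longrightarrow> finite (D b \<inter> D c)"
begin

text \<open>A condition \<open>(f, H)\<close> is an initial segment \<open>f\<close> of the function to be added together with a finite set
  \<open>H\<close> of promises: beyond \<open>f\<close>, the value at a point of \<open>D b\<close> is never \<open>col b\<close>, for \<open>b\<close> in \<open>H\<close>. The
  last clause makes the promises of one condition exclude at most one value at each point beyond \<open>f\<close>.\<close>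

definition conditions :: "(nat list \<times> 'i set) set" where
  "conditions = {(f, H). set f \<subseteq> {..n} \<and> finite H \<and> H \<subseteq> I \<and>
     (\<forall>b\<in>H. \<forall>c\<in>H. col b \<noteq> col c \<longrightarrow> D b \<inter> D c \<subseteq> {..<length f})}"

definition extends :: "(nat list \<times> 'i set) rel" where
  "extends = {((g, K), (f, H)). (g, K) \<in> conditions \<and> (f, H) \<in> conditions \<and> H \<subseteq> K \<and>
     length f \<le> length g \<and> take (length f) g = f \<and>
     (\<forall>m b. length f \<le> m \<longrightarrow> m < length g \<longrightarrow> b \<in> H \<longrightarrow> m \<in> D b \<longrightarrow> g ! m \<noteq> col b)}"

lemma extends_refl: "x \<in> conditions \<Longrightarrow> (x, x) \<in> extends"
  by (cases x) (auto simp: extends_def)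

lemma extends_trans:
  assumes "(z, y) \<in> extends" "(y, x) \<in> extends"
  shows "(z, x) \<in> extends"
proof -
  obtain h L g K f H where xyz: "z = (h, L)" "y = (g, K)" "x = (f, H)"
    by (cases x, cases y, cases z) blast
  have len: "length f \<le> length g" "length g \<le> length h"
    and tk: "take (length f) g = f" "take (length g) h = g"
    using assms unfolding extends_def xyz by auto
  have nth: "h ! m = g ! m" if "m < length g" for m
    using tk(2) that by (metis nth_take)
  have "h ! m \<noteq> col b" if "length f \<le> m" "m < length h" "b \<in> H" "m \<in> D b" for m b
    using assms that nth unfolding extends_def xyz
    by (cases "m < length g") (auto simp: subset_iff)
  moreover have "take (length f) h = f"
    using tk len by (metis min.absorb1 take_take)
  ultimately show ?thesis using assms len unfolding extends_def xyz by auto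
qed

lemma Field_extends: "Field extends = conditions"
proof
  show "Field extends \<subseteq> conditions" unfolding Field_def extends_def by auto
  show "conditions \<subseteq> Field extends" using extends_refl by (auto intro: FieldI1)
qed

lemma forcing_extends: "forcing extends"
  unfolding forcing_def preorder_on_def Field_extends
proof (intro conjI)
  show "extends \<subseteq> conditions \<times> conditions" by (auto simp: extends_def)
  show "refl_on conditions extends" using extends_refl by (auto simp: refl_on_def)
  show "trans extends" using extends_trans by (blast intro: transI)
  have "([], {}) \<in> conditions" by (simp add: conditions_def)
  then show "conditions \<noteq> {}" by blast
qed

text \<open>Each of the \<open>n\<close> conditions excludes at most one of the \<open>n + 1\<close> values at \<open>m\<close>.\<close>

lemma free_colour:
  assumes \<phi>: "\<And>i. i < n \<Longrightarrow> (f, \<phi> i) \<in> conditions" and m: "length f \<le> m"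
  shows "\<exists>y\<le>n. \<forall>i<n. \<forall>b\<in>\<phi> i. m \<in> D b \<longrightarrow> y \<noteq> col b"
proof -
  define Z where "Z i = col ` {b \<in> \<phi> i. m \<in> D b}" for i
  have Z: "finite (Z i) \<and> card (Z i) \<le> 1" if i: "i < n" for i
  proof -
    have "col b = col c" if "b \<in> \<phi> i" "c \<in> \<phi> i" "m \<in> D b" "m \<in> D c" for b c
    proof (rule ccontr)
      assume "col b \<noteq> col c"
      then have "D b \<inter> D c \<subseteq> {..<length f}"
        using \<phi>[OF i] that unfolding conditions_def by blast
      then show False using that m by auto
    qed
    then have "\<exists>x. Z i \<subseteq> {x}" unfolding Z_def by blast
    then obtain x where "Z i \<subseteq> {x}" ..
    then show ?thesis using finite_subset card_mono[of "{x}" "Z i"] by auto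
  qed
  have "(\<Sum>i<n. card (Z i)) \<le> (\<Sum>i<n. 1)" using Z by (intro sum_mono) simp
  moreover have fin: "finite (\<Union>i<n. Z i)" using Z by blast
  moreover have "card (\<Union>i<n. Z i) \<le> (\<Sum>i<n. card (Z i))"
    by (rule card_UN_le) simp
  ultimately have "card (\<Union>i<n. Z i) < card {..n}" by simp
  then have "\<not> {..n} \<subseteq> (\<Union>i<n. Z i)" using card_mono[OF fin, of "{..n}"] by linarith
  then obtain y where "y \<le> n" "y \<notin> (\<Union>i<n. Z i)" by blast
  then show ?thesis unfolding Z_def by blast
qed

text \<open>Only finitely many points lie in two of the sets \<open>D b\<close>, \<open>D c\<close> that are involved and have different
  colours. Extending the stem beyond all of them by free colours makes the union of all promises
  admissible. This gives both the linkedness and the density arguments; \<open>J\<close> and \<open>N\<close> are the extra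
  promises and the extra length that the latter need.\<close>

lemma amalgamation:
  assumes \<phi>: "\<And>i. i < n \<Longrightarrow> (f, \<phi> i) \<in> conditions" and J: "finite J" "J \<subseteq> I"
  shows "\<exists>g K. N \<le> length g \<and> J \<subseteq> K \<and> (g, K) \<in> conditions \<and>
               (\<forall>i<n. ((g, K), (f, \<phi> i)) \<in> extends)"
proof -
  define K where "K = J \<union> (\<Union>i<n. \<phi> i)"
  have KI: "K \<subseteq> I" and finK: "finite K"
    using \<phi> J unfolding K_def conditions_def by auto
  define Z where "Z = (\<Union>b\<in>K. \<Union>c\<in>{c \<in> K. col b \<noteq> col c}. D b \<inter> D c)"
  have "finite Z" unfolding Z_def using finK KI orthogonal by (intro finite_UN_I) auto
  then obtain L where L: "Z \<subseteq> {..<L}" using finite_nat_bounded by blast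
  define M where "M = max (max L N) (length f)"
  obtain y where y: "\<And>m. length f \<le> m \<Longrightarrow> y m \<le> n \<and> (\<forall>i<n. \<forall>b\<in>\<phi> i. m \<in> D b \<longrightarrow> y m \<noteq> col b)"
    using free_colour[of f \<phi>, OF \<phi>] by metis
  define g where "g = f @ map y [length f..<M]"
  have len: "length g = M" by (simp add: g_def M_def)
  have nth: "g ! m = y m" if "length f \<le> m" "m < M" for m
    using that by (simp add: g_def nth_append)
  have "set f \<subseteq> {..n}" using \<phi>[of 0] n_pos by (simp add: conditions_def)
  then have "set g \<subseteq> {..n}" using y by (auto simp: g_def)
  moreover have "D b \<inter> D c \<subseteq> {..<M}" if "b \<in> K" "c \<in> K" "col b \<noteq> col c" for b c
  proof -
    have "D b \<inter> D c \<subseteq> Z" unfolding Z_def using that by blast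
    then show ?thesis using L by (auto simp: M_def)
  qed
  ultimately have gK: "(g, K) \<in> conditions"
    using KI finK by (simp add: conditions_def len)
  moreover have "((g, K), (f, \<phi> i)) \<in> extends" if i: "i < n" for i
  proof -
    have "\<phi> i \<subseteq> K" using i by (auto simp: K_def)
    moreover have "length f \<le> length g" "take (length f) g = f" by (auto simp: g_def)
    moreover have "g ! m \<noteq> col b" if "length f \<le> m" "m < length g" "b \<in> \<phi> i" "m \<in> D b" for m b
      using y[OF that(1)] nth[OF that(1)] that i by (simp add: len)
    ultimately show ?thesis using gK \<phi>[OF i] unfolding extends_def by blast
  qed
  moreover have "N \<le> length g" "J \<subseteq> K" by (auto simp: len M_def K_def)
  ultimately show ?thesis by blast
qed

lemma sigma_n_linked_extends: "sigma_n_linked extends n"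
  unfolding sigma_n_linked_def
proof (intro exI conjI allI)
  let ?A = "\<lambda>k. {x \<in> conditions. fst x = from_nat k}"
  show "Field extends = (\<Union>k. ?A k)"
  proof
    have "x \<in> ?A (to_nat (fst x))" if "x \<in> conditions" for x using that by simp
    then show "Field extends \<subseteq> (\<Union>k. ?A k)" unfolding Field_extends by blast
  qed (auto simp: Field_extends)
  show "n_linked extends n (?A k)" for k
    unfolding n_linked_def
  proof (intro allI impI)
    fix x :: "nat \<Rightarrow> nat list \<times> 'i set"
    assume x: "\<forall>i<n. x i \<in> ?A k"
    have xi: "x i = (from_nat k, snd (x i)) \<and> x i \<in> conditions" if "i < n" for i
      using x that by (cases "x i") auto
    then obtain g K where "(g, K) \<in> conditions"
        "\<forall>i<n. ((g, K), (from_nat k, snd (x i))) \<in> extends"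
      using amalgamation[of "from_nat k" "\<lambda>i. snd (x i)" "{}" 0] by auto
    then show "\<exists>q\<in>Field extends. \<forall>i<n. (q, x i) \<in> extends"
      unfolding Field_extends using xi by (intro bexI[of _ "(g, K)"]) auto
  qed
qed

lemma dense_length: "dense_subset extends {x \<in> conditions. N \<le> length (fst x)}"
  unfolding dense_subset_def Field_extends
proof (intro conjI ballI)
  fix x assume x: "x \<in> conditions"
  obtain g K where gK: "N \<le> length g" "(g, K) \<in> conditions" "\<forall>i<n. ((g, K), x) \<in> extends"
    using amalgamation[of "fst x" "\<lambda>_. snd x" "{}" N] x by auto
  have "((g, K), x) \<in> extends" using gK(3)[rule_format, of 0] n_pos by simp
  then show "\<exists>d\<in>{x \<in> conditions. N \<le> length (fst x)}. (d, x) \<in> extends"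
    using gK(1,2) by (intro bexI[of _ "(g, K)"]) auto
qed auto

lemma dense_promise:
  assumes "b \<in> I"
  shows "dense_subset extends {x \<in> conditions. b \<in> snd x}"
  unfolding dense_subset_def Field_extends
proof (intro conjI ballI)
  fix x assume x: "x \<in> conditions"
  obtain g K where gK: "{b} \<subseteq> K" "(g, K) \<in> conditions" "\<forall>i<n. ((g, K), x) \<in> extends"
    using amalgamation[of "fst x" "\<lambda>_. snd x" "{b}" 0] x assms by auto
  have "((g, K), x) \<in> extends" using gK(3)[rule_format, of 0] n_pos by simp
  then show "\<exists>d\<in>{x \<in> conditions. b \<in> snd x}. (d, x) \<in> extends"
    using gK(1,2) by (intro bexI[of _ "(g, K)"]) auto
qed auto

text \<open>Dense sets that make the stem long and that contain each promise number fewer than the continuum,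
  so Martin's axiom provides the colouring.\<close>

lemma separating_colouring:
  assumes MA: "MA_sigma_linked n" and I: "|I| <o continuum"
  shows "\<exists>c :: nat \<Rightarrow> nat. (\<forall>m. c m \<le> n) \<and> (\<forall>b\<in>I. finite {m \<in> D b. c m = col b})"
proof -
  define \<D> where "\<D> = range (\<lambda>N. {x \<in> conditions. N \<le> length (fst x)}) \<union>
                        (\<lambda>b. {x \<in> conditions. b \<in> snd x}) ` I"
  have nat: "|UNIV :: nat set| <o continuum"
    unfolding continuum_def using card_of_Pow[of "UNIV :: nat set"] by (simp add: Pow_UNIV)
  have inf: "infinite (UNIV :: nat set set)"
    by (simp add: Finite_Set.finite_set)
  have "|\<D>| <o continuum"
    unfolding \<D>_def continuum_def
    by (rule card_of_Un_ordLess_infinite[OF inf])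
      (use nat I in \<open>auto simp: continuum_def intro: ordLeq_ordLess_trans[OF card_of_image]\<close>)
  moreover have "\<forall>E\<in>\<D>. dense_subset extends E"
    unfolding \<D>_def using dense_length dense_promise by auto
  ultimately obtain G where G: "forcing_filter extends G" "\<And>E. E \<in> \<D> \<Longrightarrow> G \<inter> E \<noteq> {}"
    using MA_sigma_linked_any_type[OF MA, where 'p = "nat list \<times> 'i set",
        unfolded MA_sigma_linked_on_def, rule_format, of extends \<D>]
      forcing_extends sigma_n_linked_extends
    by blast
  have dir: "\<exists>r\<in>G. (r, p) \<in> extends \<and> (r, q) \<in> extends" if "p \<in> G" "q \<in> G" for p q
    using G(1) that unfolding forcing_filter_def by blast
  have len: "\<exists>x\<in>G. m < length (fst x)" for m
  proof -
    have "G \<inter> {x \<in> conditions. Suc m \<le> length (fst x)} \<noteq> {}" using G(2) unfolding \<D>_def by blast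
    then show ?thesis by (auto simp: Suc_le_eq)
  qed
  have agree: "fst r ! m = fst p ! m" if "(r, p) \<in> extends" "m < length (fst p)" for r p m
  proof -
    have "take (length (fst p)) (fst r) = fst p" using that(1) unfolding extends_def by auto
    then show ?thesis using that(2) by (metis nth_take)
  qed
  define c where "c m = fst (SOME x. x \<in> G \<and> m < length (fst x)) ! m" for m
  have c: "c m = fst x ! m" if x: "x \<in> G" "m < length (fst x)" for x m
  proof -
    define y where "y = (SOME x. x \<in> G \<and> m < length (fst x))"
    have y: "y \<in> G \<and> m < length (fst y)" unfolding y_def by (rule someI) (use x in blast)
    obtain r where "(r, x) \<in> extends" "(r, y) \<in> extends" using dir x y by blast
    then have "fst y ! m = fst x ! m" using agree x y by metis
    then show ?thesis by (simp add: c_def y_def)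
  qed
  have "c m \<le> n" for m
  proof -
    obtain x where x: "x \<in> G" "m < length (fst x)" using len by blast
    then have "x \<in> conditions" using G(1) Field_extends unfolding forcing_filter_def by blast
    then have "set (fst x) \<subseteq> {..n}" by (auto simp: conditions_def)
    then show ?thesis using c[OF x] x(2) nth_mem by fastforce
  qed
  moreover have "finite {m \<in> D b. c m = col b}" if b: "b \<in> I" for b
  proof -
    have "G \<inter> {x \<in> conditions. b \<in> snd x} \<noteq> {}" using G(2) b unfolding \<D>_def by blast
    then obtain x where x: "x \<in> G" "b \<in> snd x" by blast
    have "c m \<noteq> col b" if m: "length (fst x) \<le> m" "m \<in> D b" for m
    proof -
      obtain y where y: "y \<in> G" "m < length (fst y)" using len by blast
      obtain r where r: "r \<in> G" "(r, x) \<in> extends" "(r, y) \<in> extends" using dir x y by blast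
      have "length (fst y) \<le> length (fst r)" using r(3) unfolding extends_def by auto
      then have mr: "m < length (fst r)" using y(2) by simp
      then have "fst r ! m \<noteq> col b" using r(2) x(2) m unfolding extends_def by auto
      then show ?thesis using c[OF r(1) mr] by simp
    qed
    then have "{m \<in> D b. c m = col b} \<subseteq> {..<length (fst x)}" by (auto simp: not_le[symmetric])
    then show ?thesis by (rule finite_subset) simp
  qed
  ultimately show ?thesis by blast
qed

end


section \<open>Cofinal equivalence with a product of regular cardinals\<close>

text \<open>Two preorders that are cofinal in a common one, seen without the ambient preorder: \<open>L\<close> and \<open>M\<close>
  compare elements of one with elements of the other. Elements of \<open>P\<close> and \<open>Q\<close> can then be
  interleaved, and no monotone maps between \<open>P\<close> and \<open>Q\<close> have to be chosen.\<close>

locale cofinal_pair =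
  fixes P :: "'a rel" and Q :: "'b rel" and L :: "'a \<Rightarrow> 'b \<Rightarrow> bool" and M :: "'b \<Rightarrow> 'a \<Rightarrow> bool"
  assumes L_le: "L x s \<Longrightarrow> (s, t) \<in> Q \<Longrightarrow> L x t"
    and le_M: "(s, t) \<in> Q \<Longrightarrow> M t x \<Longrightarrow> M s x"
    and M_le: "M s x \<Longrightarrow> (x, y) \<in> P \<Longrightarrow> M s y"
    and L_M: "L x s \<Longrightarrow> M s y \<Longrightarrow> (x, y) \<in> P"
    and M_L: "M s x \<Longrightarrow> L x t \<Longrightarrow> (s, t) \<in> Q"
    and ex_L: "x \<in> Field P \<Longrightarrow> \<exists>s\<in>Field Q. L x s"
    and ex_M: "s \<in> Field Q \<Longrightarrow> \<exists>x\<in>Field P. M s x"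

lemma cofinally_equiv_pair:
  fixes P :: "'a rel" and Q :: "'b rel"
  assumes "cofinally_equiv P Q"
  shows "\<exists>L M. cofinal_pair P Q L M"
proof -
  obtain R :: "('a + 'b) rel" and C D where R: "Preorder R"
    and C: "cofinal_subset C R" "order_isomorphic P (Restr R C)"
    and D: "cofinal_subset D R" "order_isomorphic Q (Restr R D)"
    using assms unfolding cofinally_equiv_def by blast
  have FC: "Field (Restr R C) = C" and FD: "Field (Restr R D) = D"
    using Field_Restr_Preorder R C(1) D(1) unfolding cofinal_subset_def by blast+
  obtain f where f: "bij_betw f (Field P) C"
      "\<And>x y. x \<in> Field P \<Longrightarrow> y \<in> Field P \<Longrightarrow> (x, y) \<in> P \<longleftrightarrow> (f x, f y) \<in> R"
    using C(2) FC unfolding order_isomorphic_def bij_betw_def by fastforce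
  obtain g where g: "bij_betw g (Field Q) D"
      "\<And>x y. x \<in> Field Q \<Longrightarrow> y \<in> Field Q \<Longrightarrow> (x, y) \<in> Q \<longleftrightarrow> (g x, g y) \<in> R"
    using D(2) FD unfolding order_isomorphic_def bij_betw_def by fastforce
  have tr: "(u, w) \<in> R" if "(u, v) \<in> R" "(v, w) \<in> R" for u v w
    using R that unfolding preorder_on_def by (blast dest: transD)
  have P: "x \<in> Field P \<and> y \<in> Field P \<and> (f x, f y) \<in> R" if "(x, y) \<in> P" for x y
    using f(2) that by (blast intro: FieldI1 FieldI2)
  have Q: "s \<in> Field Q \<and> t \<in> Field Q \<and> (g s, g t) \<in> R" if "(s, t) \<in> Q" for s t
    using g(2) that by (blast intro: FieldI1 FieldI2)
  define L where "L x s \<longleftrightarrow> x \<in> Field P \<and> s \<in> Field Q \<and> (f x, g s) \<in> R" for x s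
  define M where "M s x \<longleftrightarrow> x \<in> Field P \<and> s \<in> Field Q \<and> (g s, f x) \<in> R" for x s
  have "cofinal_pair P Q L M"
  proof
    show "\<exists>s\<in>Field Q. L x s" if x: "x \<in> Field P" for x
    proof -
      have "f x \<in> Field R" using f(1) x C(1) unfolding bij_betw_def cofinal_subset_def by auto
      then obtain d where "d \<in> D" "(f x, d) \<in> R" using D(1) unfolding cofinal_subset_def by blast
      then show ?thesis using g(1) x unfolding L_def bij_betw_def by blast
    qed
    show "\<exists>x\<in>Field P. M s x" if s: "s \<in> Field Q" for s
    proof -
      have "g s \<in> Field R" using g(1) s D(1) unfolding bij_betw_def cofinal_subset_def by auto
      then obtain d where "d \<in> C" "(g s, d) \<in> R" using C(1) unfolding cofinal_subset_def by blast
      then show ?thesis using f(1) s unfolding M_def bij_betw_def by blast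
    qed
    show "L x t" if "L x s" "(s, t) \<in> Q" for x s t
      using Q[OF that(2)] that(1) tr unfolding L_def by blast
    show "M s x" if "(s, t) \<in> Q" "M t x" for s t x
      using Q[OF that(1)] that(2) tr unfolding M_def by blast
    show "M s y" if "M s x" "(x, y) \<in> P" for s x y
      using P[OF that(2)] that(1) tr unfolding M_def by blast
    show "(x, y) \<in> P" if "L x s" "M s y" for x s y
      using that f(2) tr unfolding L_def M_def by blast
    show "(s, t) \<in> Q" if "M s x" "L x t" for s x t
      using that g(2) tr unfolding L_def M_def by blast
  qed
  then show ?thesis by blast
qed

lemma cofinally_equiv_iso:
  fixes P :: "'a rel" and Q :: "'b rel" and Q' :: "'c rel"
  assumes "cofinally_equiv P Q" "order_isomorphic Q' Q"
  shows "cofinally_equiv P Q'"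
proof -
  obtain R :: "('a + 'b) rel" and C D where R: "Preorder R"
    and C: "cofinal_subset C R" "order_isomorphic P (Restr R C)"
    and D: "cofinal_subset D R" "order_isomorphic Q (Restr R D)"
    using assms(1) unfolding cofinally_equiv_def by blast
  obtain h where h: "bij_betw h (Field Q') (Field Q)"
      "\<forall>x\<in>Field Q'. \<forall>y\<in>Field Q'. (x, y) \<in> Q' \<longleftrightarrow> (h x, h y) \<in> Q"
    using assms(2) unfolding order_isomorphic_def by blast
  obtain e where e: "bij_betw e (Field Q) (Field (Restr R D))"
      "\<forall>x\<in>Field Q. \<forall>y\<in>Field Q. (x, y) \<in> Q \<longleftrightarrow> (e x, e y) \<in> Restr R D"
    using D(2) unfolding order_isomorphic_def by blast
  have hF: "h x \<in> Field Q" if "x \<in> Field Q'" for x using h(1) that by (auto simp: bij_betw_def)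
  have "order_isomorphic Q' (Restr R D)"
    unfolding order_isomorphic_def
  proof (intro exI[of _ "e \<circ> h"] conjI ballI)
    show "bij_betw (e \<circ> h) (Field Q') (Field (Restr R D))"
      using bij_betw_trans[OF h(1) e(1)] .
    show "(x, y) \<in> Q' \<longleftrightarrow> ((e \<circ> h) x, (e \<circ> h) y) \<in> Restr R D"
      if "x \<in> Field Q'" "y \<in> Field Q'" for x y
      using that h(2) e(2) hF by (metis comp_apply)
  qed
  then show ?thesis using cofinally_equivI[OF R C D(1)] by blast
qed

lemma Card_order_trans: "Card_order r \<Longrightarrow> (x, y) \<in> r \<Longrightarrow> (y, z) \<in> r \<Longrightarrow> (x, z) \<in> r"
  unfolding card_order_on_def well_order_on_def linear_order_on_def
    partial_order_on_def preorder_on_def trans_def by blast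

lemma Card_order_antisym: "Card_order r \<Longrightarrow> (x, y) \<in> r \<Longrightarrow> (y, x) \<in> r \<Longrightarrow> x = y"
  unfolding card_order_on_def well_order_on_def linear_order_on_def
    partial_order_on_def antisym_def by blast

lemma Card_order_total:
  assumes "Card_order r" "x \<in> Field r" "y \<in> Field r"
  shows "(x, y) \<in> r \<or> (y, x) \<in> r"
proof (cases "x = y")
  case True
  have "refl_on (Field r) r"
    using assms(1) unfolding card_order_on_def well_order_on_def linear_order_on_def
      partial_order_on_def preorder_on_def by blast
  then show ?thesis using True assms(2) by (simp add: refl_on_def)
next
  case False
  have "total_on (Field r) r"
    using assms(1) unfolding card_order_on_def well_order_on_def linear_order_on_def by blast
  then show ?thesis using False assms(2,3) by (simp add: total_on_def)
qed

lemma regular_cardinal_Card_order: "regular_cardinal r \<Longrightarrow> Card_order r"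
  by (simp add: regular_cardinal_def)

lemma regular_cardinal_refl: "regular_cardinal r \<Longrightarrow> x \<in> Field r \<Longrightarrow> (x, x) \<in> r"
  using Card_order_total[of r x x] regular_cardinal_Card_order[of r] by simp

lemma regular_cardinal_nonempty: "regular_cardinal r \<Longrightarrow> Field r \<noteq> {}"
  unfolding regular_cardinal_def by auto

lemma regular_cardinal_bounded:
  assumes r: "regular_cardinal r" and K: "K \<subseteq> Field r"
    and small: "infinite (Field r) \<Longrightarrow> |K| <o r"
  shows "\<exists>a\<in>Field r. \<forall>b\<in>K. (b, a) \<in> r"
proof (cases "finite (Field r)")
  case True
  then have "card (Field r) = 1" using r by (simp add: regular_cardinal_def)
  then obtain a where "Field r = {a}" by (rule card_1_singletonE)
  then show ?thesis using K regular_cardinal_refl[OF r] by auto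
next
  case False
  then have "\<not> |K| =o r" using small not_ordLess_ordIso by blast
  then have "\<not> cofinal K r"
    using r False K unfolding regular_cardinal_def regularCard_def by auto
  then obtain a where a: "a \<in> Field r" "\<And>b. b \<in> K \<Longrightarrow> a = b \<or> (a, b) \<notin> r"
    unfolding cofinal_def by blast
  then show ?thesis
    using Card_order_total[OF regular_cardinal_Card_order[OF r] _ a(1)] regular_cardinal_refl[OF r a(1)] K by blast
qed

lemma prod_order_nth: "(s, t) \<in> prod_order S \<Longrightarrow> r \<in> S \<Longrightarrow> (s r, t r) \<in> r"
  by (simp add: prod_order_def)

context
  fixes S :: "'k rel set"
  assumes S: "set_of_regular_cardinals S"
begin

lemma member_regular: "r \<in> S \<Longrightarrow> regular_cardinal r"
  using S by (simp add: set_of_regular_cardinals_def)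

lemma Field_prod_order: "Field (prod_order S) = Pi\<^sub>E S Field"
proof
  show "Field (prod_order S) \<subseteq> Pi\<^sub>E S Field" unfolding prod_order_def Field_def by auto
  show "Pi\<^sub>E S Field \<subseteq> Field (prod_order S)"
  proof
    fix f assume "f \<in> Pi\<^sub>E S Field"
    then have "(f, f) \<in> prod_order S"
      unfolding prod_order_def using regular_cardinal_refl[OF member_regular] by auto
    then show "f \<in> Field (prod_order S)" by (rule FieldI1)
  qed
qed

lemma prod_order_bound:
  assumes T: "T \<subseteq> Field (prod_order S)"
    and b: "\<And>r. r \<in> S \<Longrightarrow> b r \<in> Field r \<and> (\<forall>t\<in>T. (t r, b r) \<in> r)"
  shows "restrict b S \<in> Field (prod_order S)"
    and "t \<in> T \<Longrightarrow> (t, restrict b S) \<in> prod_order S"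
proof -
  show *: "restrict b S \<in> Field (prod_order S)" using b unfolding Field_prod_order by auto
  show "(t, restrict b S) \<in> prod_order S" if "t \<in> T"
    using that b T * unfolding Field_prod_order unfolding prod_order_def by auto
qed

lemma prod_order_point:
  assumes "k \<in> S" "a \<in> Field k"
  shows "\<exists>s\<in>Field (prod_order S). s k = a"
proof
  show "(\<lambda>r\<in>S. if r = k then a else SOME x. x \<in> Field r) \<in> Field (prod_order S)"
    unfolding Field_prod_order
    using assms regular_cardinal_nonempty[OF member_regular] by (auto simp: some_in_eq)
qed (use assms in simp)

text \<open>Coordinatewise suprema: a set that is small compared with every factor except \<open>k\<close> is bounded as
  soon as its \<open>k\<close>-coordinates are, and the \<open>k\<close>-coordinate of the bound can be prescribed.\<close>

lemma prod_order_bounded: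
  assumes T: "T \<subseteq> Field (prod_order S)"
    and small: "\<And>r. r \<in> S \<Longrightarrow> r \<noteq> k \<Longrightarrow> infinite (Field r) \<Longrightarrow> |T| <o r"
    and k: "k \<in> S \<Longrightarrow> a \<in> Field k \<and> (\<forall>t\<in>T. (t k, a) \<in> k)"
  shows "\<exists>u\<in>Field (prod_order S). (k \<in> S \<longrightarrow> u k = a) \<and> (\<forall>t\<in>T. (t, u) \<in> prod_order S)"
proof -
  have "\<exists>x. x \<in> Field r \<and> (\<forall>t\<in>T. (t r, x) \<in> r) \<and> (r = k \<longrightarrow> x = a)" if r: "r \<in> S" for r
  proof (cases "r = k")
    case True
    then show ?thesis using k r by blast
  next
    case False
    have "(\<lambda>t. t r) ` T \<subseteq> Field r" using T r unfolding Field_prod_order by auto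
    moreover have "|(\<lambda>t. t r) ` T| <o r" if "infinite (Field r)"
      using small[OF r False that] by (rule ordLeq_ordLess_trans[OF card_of_image])
    ultimately show ?thesis
      using regular_cardinal_bounded[OF member_regular[OF r], of "(\<lambda>t. t r) ` T"] False by auto
  qed
  then obtain b where b: "\<And>r. r \<in> S \<Longrightarrow> b r \<in> Field r \<and> (\<forall>t\<in>T. (t r, b r) \<in> r)"
      "k \<in> S \<Longrightarrow> b k = a" by metis
  have "restrict b S \<in> Field (prod_order S)" "\<And>t. t \<in> T \<Longrightarrow> (t, restrict b S) \<in> prod_order S"
    using prod_order_bound[OF T, of b] b(1) by blast+
  then show ?thesis using b(2) by (intro bexI[of _ "restrict b S"]) auto
qed

end

context
  fixes S :: "'k rel set" and P :: "'a rel" and k :: "'k rel"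
  assumes S: "set_of_regular_cardinals S" and PS: "cofinally_equiv P (prod_order S)"
    and k: "k \<in> S" "infinite (Field k)"
    and least: "\<forall>r\<in>S. infinite (Field r) \<longrightarrow> k \<le>o r"
begin

lemma directed_below_least:
  assumes X: "X \<subseteq> Field P" "|X| <o k"
  shows "\<exists>u\<in>Field P. \<forall>x\<in>X. (x, u) \<in> P"
proof -
  obtain L M where "cofinal_pair P (prod_order S) L M" using cofinally_equiv_pair[OF PS] by blast
  then interpret cofinal_pair P "prod_order S" L M .
  have "\<forall>x\<in>X. \<exists>s. s \<in> Field (prod_order S) \<and> L x s" using ex_L X(1) by blast
  then obtain v where v: "\<And>x. x \<in> X \<Longrightarrow> v x \<in> Field (prod_order S) \<and> L x (v x)"
    by metis
  have vX: "v ` X \<subseteq> Field (prod_order S)" using v by auto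
  have card: "|v ` X| <o r" if "r \<in> S" "infinite (Field r)" for r
    by (rule ordLeq_ordLess_trans[OF card_of_image ordLess_ordLeq_trans[OF X(2) least[rule_format, OF that]]])
  have kX: "\<exists>a\<in>Field k. \<forall>t\<in>v ` X. (t k, a) \<in> k"
  proof -
    have "(\<lambda>t. t k) ` v ` X \<subseteq> Field k" using vX k(1) unfolding Field_prod_order[OF S] by auto
    moreover have "|(\<lambda>t. t k) ` v ` X| <o k"
      by (rule ordLeq_ordLess_trans[OF card_of_image card[OF k]])
    ultimately show ?thesis
      using regular_cardinal_bounded[OF member_regular[OF S k(1)], of "(\<lambda>t. t k) ` v ` X"] by auto
  qed
  then obtain a where "a \<in> Field k" "\<forall>t\<in>v ` X. (t k, a) \<in> k" by blast
  then obtain t where t: "t \<in> Field (prod_order S)" "\<forall>s\<in>v ` X. (s, t) \<in> prod_order S"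
    using prod_order_bounded[OF S vX, of k a] card by blast
  obtain u where u: "u \<in> Field P" "M t u" using ex_M[OF t(1)] by blast
  have "(x, u) \<in> P" if "x \<in> X" for x
    using v[OF that] t(2) that u(2) by (blast intro: L_M L_le)
  then show ?thesis using u(1) by blast
qed

text \<open>\<open>P\<close> is the union of an increasing chain of length \<open>k\<close> of proper parts that are closed downwards and
  under joins. The natural candidate for the part \<open>N a\<close> consists of the elements that lie below some
  \<open>t\<close> whose \<open>k\<close>-coordinate is at most \<open>a\<close>. A join in \<open>P\<close> need not be a join in the ambient
  preorder, so this candidate need not be closed under joins; requiring instead that the
  element lies below every element of \<open>P\<close> above \<open>t\<close> repairs this. The price is that properness is no longer immediate. It
  holds because the factors other than \<open>k\<close> are longer than \<open>k\<close> (here it matters that the factors form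
  a set, not a multiset): were \<open>N a\<close> everything, \<open>k\<close> many witnesses \<open>t\<close>, for a sequence
  of elements whose \<open>k\<close>-coordinates exhaust \<open>k\<close>, would have a common upper bound.\<close>

lemma filtration_below_least:
  obtains N :: "'k \<Rightarrow> 'a set" where
    "\<And>a b. (a, b) \<in> k \<Longrightarrow> N a \<subseteq> N b"
    "\<And>x. x \<in> Field P \<Longrightarrow> \<exists>a\<in>Field k. x \<in> N a"
    "\<And>a. a \<in> Field k \<Longrightarrow> \<exists>x\<in>Field P. x \<notin> N a"
    "\<And>a x y z. x \<in> N a \<Longrightarrow> y \<in> N a \<Longrightarrow> z \<in> Field P \<Longrightarrow>
       \<forall>w\<in>Field P. (x, w) \<in> P \<longrightarrow> (y, w) \<in> P \<longrightarrow> (z, w) \<in> P \<Longrightarrow> z \<in> N a"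
proof -
  obtain L M where "cofinal_pair P (prod_order S) L M" using cofinally_equiv_pair[OF PS] by blast
  then interpret cofinal_pair P "prod_order S" L M .
  have regk: "regular_cardinal k" using member_regular[OF S k(1)] .
  define N where "N a = {x \<in> Field P. \<exists>t\<in>Field (prod_order S). (t k, a) \<in> k \<and>
      (\<forall>w\<in>Field P. M t w \<longrightarrow> (x, w) \<in> P)}" for a
  have mono: "N a \<subseteq> N b" if "(a, b) \<in> k" for a b
    using that Card_order_trans[OF regular_cardinal_Card_order[OF regk]] unfolding N_def by blast
  have cover: "\<exists>a\<in>Field k. x \<in> N a" if x: "x \<in> Field P" for x
  proof -
    obtain t where t: "t \<in> Field (prod_order S)" "L x t" using ex_L[OF x] by blast
    have tk: "t k \<in> Field k" using t(1) k(1) unfolding Field_prod_order[OF S] by auto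
    have "x \<in> N (t k)"
      unfolding N_def using x t regular_cardinal_refl[OF regk tk] L_M by blast
    then show ?thesis using tk by blast
  qed
  have proper: "\<exists>x\<in>Field P. x \<notin> N a" if a: "a \<in> Field k" for a
  proof (rule ccontr)
    assume "\<not> ?thesis"
    then have all: "x \<in> N a" if "x \<in> Field P" for x using that by blast
    have "\<exists>s t. s \<in> Field (prod_order S) \<and> s k = c \<and> t \<in> Field (prod_order S) \<and> (t k, a) \<in> k \<and>
        (\<forall>w\<in>Field P. M t w \<longrightarrow> M s w)" if c: "c \<in> Field k" for c
    proof -
      obtain s where s: "s \<in> Field (prod_order S)" "s k = c"
        using prod_order_point[OF S k(1) c] by blast
      obtain x where x: "x \<in> Field P" "M s x" using ex_M[OF s(1)] by blast
      obtain t where t: "t \<in> Field (prod_order S)" "(t k, a) \<in> k"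
          "\<forall>w\<in>Field P. M t w \<longrightarrow> (x, w) \<in> P"
        using all[OF x(1)] unfolding N_def by blast
      have "\<forall>w\<in>Field P. M t w \<longrightarrow> M s w" using t(3) x(2) M_le by blast
      then show ?thesis using s t(1,2) by blast
    qed
    then obtain s t where st: "\<And>c. c \<in> Field k \<Longrightarrow>
        s c \<in> Field (prod_order S) \<and> s c k = c \<and> t c \<in> Field (prod_order S) \<and> (t c k, a) \<in> k \<and>
        (\<forall>w\<in>Field P. M (t c) w \<longrightarrow> M (s c) w)"
      by metis
    have tF: "t ` Field k \<subseteq> Field (prod_order S)" using st by blast
    have small: "|t ` Field k| <o r" if r: "r \<in> S" "r \<noteq> k" "infinite (Field r)" for r
    proof -
      have "\<not> k =o r" using S k(1) r unfolding set_of_regular_cardinals_def by blast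
      then have "k <o r" using least[rule_format, OF r(1,3)] ordLeq_iff_ordLess_or_ordIso by blast
      moreover have "|t ` Field k| \<le>o k"
        using ordLeq_ordIso_trans[OF card_of_image card_of_Field_ordIso] regk
        unfolding regular_cardinal_def by blast
      ultimately show ?thesis by (rule ordLeq_ordLess_trans[rotated])
    qed
    have "\<exists>u\<in>Field (prod_order S). (k \<in> S \<longrightarrow> u k = a) \<and> (\<forall>s\<in>t ` Field k. (s, u) \<in> prod_order S)"
      by (rule prod_order_bounded[OF S tF small]) (use a st in blast)+
    then obtain u where u: "u \<in> Field (prod_order S)" "\<And>c. c \<in> Field k \<Longrightarrow> (t c, u) \<in> prod_order S"
      by blast
    obtain w where w: "w \<in> Field P" "M u w" using ex_M[OF u(1)] by blast
    obtain v where v: "v \<in> Field (prod_order S)" "L w v" using ex_L[OF w(1)] by blast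
    have below: "(c, v k) \<in> k" if c: "c \<in> Field k" for c
    proof -
      have "M (t c) w" using le_M[OF u(2)[OF c] w(2)] .
      then have "(s c, v) \<in> prod_order S" using st[OF c] w(1) v(2) M_L by blast
      then have "(s c k, v k) \<in> k" by (rule prod_order_nth[OF _ k(1)])
      then show ?thesis using st[OF c] by simp
    qed
    have vk: "v k \<in> Field k" using v(1) k(1) unfolding Field_prod_order[OF S] by auto
    obtain c where "c \<in> Field k" "v k \<noteq> c" "(v k, c) \<in> k"
      using infinite_Card_order_limit[OF _ k(2) vk] regk unfolding regular_cardinal_def by blast
    then show False using below Card_order_antisym[OF regular_cardinal_Card_order[OF regk]] by blast
  qed
  have closed: "z \<in> N a"
    if xy: "x \<in> N a" "y \<in> N a" and z: "z \<in> Field P"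
      and zw: "\<forall>w\<in>Field P. (x, w) \<in> P \<longrightarrow> (y, w) \<in> P \<longrightarrow> (z, w) \<in> P" for a x y z
  proof -
    obtain s where s: "s \<in> Field (prod_order S)" "(s k, a) \<in> k"
        "\<forall>w\<in>Field P. M s w \<longrightarrow> (x, w) \<in> P"
      using xy(1) unfolding N_def by blast
    obtain t where t: "t \<in> Field (prod_order S)" "(t k, a) \<in> k"
        "\<forall>w\<in>Field P. M t w \<longrightarrow> (y, w) \<in> P"
      using xy(2) unfolding N_def by blast
    have a: "a \<in> Field k" using s(2) by (rule FieldI2)
    have small: "|{s, t}| <o r" if "r \<in> S" "infinite (Field r)" for r
    proof (rule finite_ordLess_infinite)
      show "Well_order r"
        using member_regular[OF S that(1)] unfolding regular_cardinal_def card_order_on_def by blast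
      show "Well_order |{s, t}|" by (rule card_of_Well_order)
    qed (use that(2) in \<open>simp_all add: Field_card_of\<close>)
    have "\<exists>u\<in>Field (prod_order S). (k \<in> S \<longrightarrow> u k = a) \<and> (\<forall>q\<in>{s, t}. (q, u) \<in> prod_order S)"
    proof (rule prod_order_bounded[OF S])
      show "{s, t} \<subseteq> Field (prod_order S)" using s(1) t(1) by simp
      show "a \<in> Field k \<and> (\<forall>q\<in>{s, t}. (q k, a) \<in> k)" using a s(2) t(2) by simp
    qed (rule small)
    then obtain u where u: "u \<in> Field (prod_order S)" "u k = a"
        "(s, u) \<in> prod_order S" "(t, u) \<in> prod_order S"
      using k(1) by blast
    have "(z, w) \<in> P" if w: "w \<in> Field P" "M u w" for w
      using le_M[OF u(3) w(2)] le_M[OF u(4) w(2)] s(3) t(3) zw w(1) by blast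
    moreover have "(u k, a) \<in> k" using u(2) regular_cardinal_refl[OF regk a] by simp
    ultimately show ?thesis unfolding N_def using z u(1) by blast
  qed
  show thesis
    by (rule that[of N]) (fact mono cover proper closed)+
qed

end

text \<open>By regularity, upper bounds in the product of the elements of a cofinal set of size less than \<open>r\<close>
  would have bounded \<open>r\<close>-coordinates.\<close>

lemma factor_le_cofinal_set:
  assumes S: "set_of_regular_cardinals S" and PS: "cofinally_equiv P (prod_order S)"
    and r: "r \<in> S" "infinite (Field r)" and C: "cofinal_subset C P"
  shows "r \<le>o |C|"
proof (rule ccontr)
  assume "\<not> r \<le>o |C|"
  have reg: "regular_cardinal r" using member_regular[OF S r(1)] .
  then have "|C| <o r"
    using \<open>\<not> r \<le>o |C|\<close> not_ordLeq_iff_ordLess[of "|C|" r] card_of_Well_order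
    unfolding regular_cardinal_def card_order_on_def by blast
  obtain L M where "cofinal_pair P (prod_order S) L M" using cofinally_equiv_pair[OF PS] by blast
  then interpret cofinal_pair P "prod_order S" L M .
  have "\<forall>x\<in>C. \<exists>s. s \<in> Field (prod_order S) \<and> L x s"
    using ex_L C unfolding cofinal_subset_def by blast
  then obtain v where v: "\<And>x. x \<in> C \<Longrightarrow> v x \<in> Field (prod_order S) \<and> L x (v x)"
    by metis
  have "(\<lambda>x. v x r) ` C \<subseteq> Field r" using v r(1) unfolding Field_prod_order[OF S] by auto
  moreover have "|(\<lambda>x. v x r) ` C| <o r"
    by (rule ordLeq_ordLess_trans[OF card_of_image \<open>|C| <o r\<close>])
  ultimately obtain a where a: "a \<in> Field r" "\<And>x. x \<in> C \<Longrightarrow> (v x r, a) \<in> r"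
    using regular_cardinal_bounded[OF reg, of "(\<lambda>x. v x r) ` C"] by auto
  obtain b where b: "b \<in> Field r" "a \<noteq> b" "(a, b) \<in> r"
    using infinite_Card_order_limit[OF _ r(2) a(1)] reg unfolding regular_cardinal_def by blast
  obtain s where s: "s \<in> Field (prod_order S)" "s r = b"
    using prod_order_point[OF S r(1) b(1)] by blast
  obtain y where y: "y \<in> Field P" "M s y" using ex_M[OF s(1)] by blast
  obtain x where x: "x \<in> C" "(y, x) \<in> P" using C y(1) unfolding cofinal_subset_def by blast
  have "(s, v x) \<in> prod_order S" using M_L M_le[OF y(2) x(2)] v[OF x(1)] by blast
  then have "(s r, v x r) \<in> r" by (rule prod_order_nth[OF _ r(1)])
  then have "(b, a) \<in> r" using s(2) a(2)[OF x(1)] Card_order_trans[OF regular_cardinal_Card_order[OF reg]] by blast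
  then show False using b(2,3) Card_order_antisym[OF regular_cardinal_Card_order[OF reg]] by blast
qed

lemma greatest_if_no_infinite_factor:
  assumes S: "set_of_regular_cardinals S" and PS: "cofinally_equiv P (prod_order S)"
    and fin: "\<And>r. r \<in> S \<Longrightarrow> finite (Field r)"
  shows "\<exists>w\<in>Field P. \<forall>x\<in>Field P. (x, w) \<in> P"
proof -
  obtain L M where "cofinal_pair P (prod_order S) L M" using cofinally_equiv_pair[OF PS] by blast
  then interpret cofinal_pair P "prod_order S" L M .
  obtain t where t: "t \<in> Field (prod_order S)" "\<And>s. s \<in> Field (prod_order S) \<Longrightarrow> (s, t) \<in> prod_order S"
  proof -
    have "\<exists>a. a \<in> Field r \<and> (\<forall>s\<in>Field (prod_order S). (s r, a) \<in> r)" if r: "r \<in> S" for r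
    proof -
      have "\<exists>a\<in>Field r. \<forall>b\<in>Field r. (b, a) \<in> r"
        by (rule regular_cardinal_bounded[OF member_regular[OF S r]]) (use fin[OF r] in auto)
      then show ?thesis using r unfolding Field_prod_order[OF S] by blast
    qed
    then obtain a where "\<And>r. r \<in> S \<Longrightarrow> a r \<in> Field r \<and> (\<forall>s\<in>Field (prod_order S). (s r, a r) \<in> r)"
      by metis
    from prod_order_bound[OF S order_refl this] that show thesis by blast
  qed
  obtain w where w: "w \<in> Field P" "M t w" using ex_M[OF t(1)] by blast
  have "(x, w) \<in> P" if x: "x \<in> Field P" for x
    using ex_L[OF x] t(2) w(2) L_M L_le by blast
  then show ?thesis using w(1) by blast
qed

lemma prod_order_iso_single_infinite_factor:
  assumes S: "set_of_regular_cardinals S" and k: "k \<in> S" "k =o c"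
    and fin: "\<And>r. r \<in> S \<Longrightarrow> r \<noteq> k \<Longrightarrow> finite (Field r)"
  shows "order_isomorphic c (prod_order S)"
proof -
  have "c =o k" using k(2) by (rule ordIso_symmetric)
  then obtain h where "iso c k h" unfolding ordIso_def by blast
  then have h: "bij_betw h (Field c) (Field k)"
      "\<And>x y. x \<in> Field c \<Longrightarrow> y \<in> Field c \<Longrightarrow> (x, y) \<in> c \<longleftrightarrow> (h x, h y) \<in> k"
    unfolding iso_iff2 by auto
  have "\<exists>a. Field r = {a}" if "r \<in> S" "r \<noteq> k" for r
  proof -
    have "card (Field r) = 1"
      using member_regular[OF S that(1)] fin[OF that] by (auto simp: regular_cardinal_def)
    then show ?thesis by (rule card_1_singletonE) blast
  qed
  then obtain a where a: "\<And>r. r \<in> S \<Longrightarrow> r \<noteq> k \<Longrightarrow> Field r = {a r}" by metis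
  define e where "e x = (\<lambda>r\<in>S. if r = k then h x else a r)" for x
  have hF: "h x \<in> Field k" if "x \<in> Field c" for x using h(1) that by (auto simp: bij_betw_def)
  have eF: "e x \<in> Pi\<^sub>E S Field" if "x \<in> Field c" for x
    using a hF[OF that] by (auto simp: e_def)
  have ek: "e x k = h x" for x using k(1) by (simp add: e_def)
  have "bij_betw e (Field c) (Pi\<^sub>E S Field)"
  proof (rule bij_betwI')
    fix x y assume "x \<in> Field c" "y \<in> Field c"
    then show "(e x = e y) = (x = y)"
      using h(1) ek unfolding bij_betw_def inj_on_def by metis
  next
    fix s assume s: "s \<in> Pi\<^sub>E S Field"
    then have "s k \<in> Field k" using k(1) by auto
    then obtain x where x: "x \<in> Field c" "h x = s k" using h(1) unfolding bij_betw_def by force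
    have "s r = e x r" for r
    proof (cases "r \<in> S \<and> r \<noteq> k")
      case True
      then have "s r \<in> Field r" using s by blast
      then show ?thesis using a[of r] True by (simp add: e_def)
    next
      case False
      then show ?thesis using x(2) ek PiE_arb[OF s] by (auto simp: e_def)
    qed
    then have "s = e x" by (rule ext)
    then show "\<exists>x\<in>Field c. s = e x" using x(1) by blast
  qed (rule eF)
  moreover have "(x, y) \<in> c \<longleftrightarrow> (e x, e y) \<in> prod_order S" if xy: "x \<in> Field c" "y \<in> Field c" for x y
  proof
    assume "(x, y) \<in> c"
    then have hxy: "(h x, h y) \<in> k" using h(2) xy by blast
    have "(e x r, e y r) \<in> r" if r: "r \<in> S" for r
    proof (cases "r = k")
      case True
      then show ?thesis using hxy ek by simp
    next
      case False
      then have "(a r, a r) \<in> r" using a r regular_cardinal_refl[OF member_regular[OF S r]] by simp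
      then show ?thesis using False r by (simp add: e_def)
    qed
    then show "(e x, e y) \<in> prod_order S" unfolding prod_order_def using eF xy by blast
  next
    assume "(e x, e y) \<in> prod_order S"
    then have "(e x k, e y k) \<in> k" by (rule prod_order_nth[OF _ k(1)])
    then have "(h x, h y) \<in> k" by (simp add: ek)
    then show "(x, y) \<in> c" using h(2) xy by blast
  qed
  ultimately show ?thesis unfolding order_isomorphic_def Field_prod_order[OF S] by blast
qed


section \<open>A filtration of an ultrafilter of small regular length is impossible\<close>

text \<open>A bijection of \<open>k\<close> with \<open>k \<times> {0,\<dots>,n}\<close> makes every class as large as \<open>k\<close>, and sets of that size
  are cofinal in \<open>k\<close>.\<close>

lemma cofinal_colouring:
  assumes k: "Card_order k" "infinite (Field k)"
  shows "\<exists>col :: 'k \<Rightarrow> nat. \<forall>i\<le>n. \<forall>a\<in>Field k. \<exists>b\<in>Field k. col b = i \<and> (a, b) \<in> k"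
proof -
  have "|Field k \<times> {..n}| =o |Field k|"
  proof (rule card_of_Times_infinite_simps(1)[OF k(2)])
    show "{..n} \<noteq> {}" by auto
    show "|{..n}| \<le>o |Field k|"
      using finite_ordLess_infinite[OF card_of_Well_order card_of_Well_order, of "{..n}" "Field k"] k(2)
      by (simp add: Field_card_of ordLess_imp_ordLeq)
  qed
  then obtain h where h: "bij_betw h (Field k) (Field k \<times> {..n})"
    using card_of_ordIso[of "Field k" "Field k \<times> {..n}"] ordIso_symmetric[of "|Field k \<times> {..n}|"]
    by blast
  have "\<exists>b\<in>Field k. (snd \<circ> h) b = i \<and> (a, b) \<in> k" if i: "i \<le> n" and a: "a \<in> Field k" for i a
  proof (rule ccontr)
    assume no: "\<not> ?thesis"
    define C where "C = {b \<in> Field k. snd (h b) = i}"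
    have "Field k \<subseteq> (fst \<circ> h) ` C"
    proof
      fix x assume "x \<in> Field k"
      then have "(x, i) \<in> h ` Field k" using h i unfolding bij_betw_def by auto
      then obtain b where "b \<in> Field k" "h b = (x, i)" by auto
      then show "x \<in> (fst \<circ> h) ` C" unfolding C_def by (intro image_eqI[of _ _ b]) auto
    qed
    then have "|Field k| \<le>o |C|" by (rule ordLeq_transitive[OF card_of_mono1 card_of_image])
    moreover have "C \<subseteq> underS k a"
    proof
      fix b assume b: "b \<in> C"
      then have bF: "b \<in> Field k" and "(a, b) \<notin> k" using no unfolding C_def by auto
      moreover have "(b, a) \<in> k" and "(a, a) \<in> k"
        using Card_order_total[OF k(1)] a bF \<open>(a, b) \<notin> k\<close> by blast+
      ultimately show "b \<in> underS k a" unfolding underS_def by blast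
    qed
    then have "|C| <o k" by (rule ordLeq_ordLess_trans[OF card_of_mono1 card_of_underS[OF k(1) a]])
    ultimately have "|Field k| <o k" by (rule ordLeq_ordLess_trans)
    then show False using not_ordLess_ordIso[of "|Field k|" k] card_of_Field_ordIso[OF k(1)] by blast
  qed
  then show ?thesis by blast
qed

text \<open>The heart of the proof. Directedness modulo finite and properness of the filtration yield, by
  recursion on \<open>b\<close>, pairwise almost disjoint sets \<open>D b\<close> whose complements belong to \<open>p\<close> but not to
  \<open>N b\<close>. Colour the indices with \<open>n + 1\<close> colours, each used cofinally often. A colouring
  \<open>c\<close> that separates the resulting families has a class \<open>c\<^sup>-\<^sup>1(i)\<close> in \<open>p\<close>, hence in some \<open>N a\<close>. This class is almost contained in the
  complement of \<open>D b\<close> for every \<open>b\<close> of colour \<open>i\<close>, also for some \<open>b\<close> above \<open>a\<close>, and so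
  that complement does belong to \<open>N b\<close>.\<close>

lemma no_short_filtration:
  fixes p :: "nat filter" and N :: "'k \<Rightarrow> nat set set"
  assumes MA: "MA_sigma_linked n" "n \<ge> 1"
    and k: "Card_order k" "infinite (Field k)" "k <o continuum"
    and p: "ultrafilter p"
    and mono: "\<And>a b. (a, b) \<in> k \<Longrightarrow> N a \<subseteq> N b"
    and cover: "\<And>A. eventually (\<lambda>m. m \<in> A) p \<Longrightarrow> \<exists>a\<in>Field k. A \<in> N a"
    and proper: "\<And>a. a \<in> Field k \<Longrightarrow> \<exists>A. eventually (\<lambda>m. m \<in> A) p \<and> A \<notin> N a"
    and closed: "\<And>a A B C. A \<in> N a \<Longrightarrow> B \<in> N a \<Longrightarrow> eventually (\<lambda>m. m \<in> C) p \<Longrightarrow>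
                   finite (A \<inter> B - C) \<Longrightarrow> C \<in> N a"
    and directed: "\<And>\<A>. (\<And>A. A \<in> \<A> \<Longrightarrow> eventually (\<lambda>m. m \<in> A) p) \<Longrightarrow> |\<A>| <o k \<Longrightarrow>
                   \<exists>B. eventually (\<lambda>m. m \<in> B) p \<and> (\<forall>A\<in>\<A>. finite (B - A))"
  shows False
proof -
  have wo: "Well_order k" using k(1) by (simp add: card_order_on_def)
  note total = Card_order_total[OF k(1)]
  have step: "\<exists>X. b \<in> Field k \<longrightarrow> eventually (\<lambda>m. m \<in> - X) p \<and> - X \<notin> N b \<and>
      (\<forall>c\<in>underS k b. finite (X \<inter> D c))"
    if D: "\<And>c. (c, b) \<in> k - Id \<Longrightarrow> c \<in> Field k \<longrightarrow> eventually (\<lambda>m. m \<in> - D c) p"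
    for b and D :: "'k \<Rightarrow> nat set"
  proof (cases "b \<in> Field k")
    case b: True
    have "eventually (\<lambda>m. m \<in> A) p" if A: "A \<in> (\<lambda>c. - D c) ` underS k b" for A
    proof -
      obtain c where c: "c \<in> underS k b" "A = - D c" using A by blast
      have cb: "(c, b) \<in> k" "c \<noteq> b" using c(1) unfolding underS_def by simp_all
      then have "c \<in> Field k" by (blast intro: FieldI1)
      then show ?thesis using D[of c] cb c(2) by simp
    qed
    moreover have "|(\<lambda>c. - D c) ` underS k b| <o k"
      by (rule ordLeq_ordLess_trans[OF card_of_image card_of_underS[OF k(1) b]])
    ultimately obtain B where B: "eventually (\<lambda>m. m \<in> B) p"
        "\<And>c. c \<in> underS k b \<Longrightarrow> finite (B \<inter> D c)"
    proof -
      have "\<exists>B. eventually (\<lambda>m. m \<in> B) p \<and> (\<forall>A\<in>(\<lambda>c. - D c) ` underS k b. finite (B - A))"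
        by (rule directed) fact+
      then show thesis using that by (auto simp: Diff_eq)
    qed
    \<comment> \<open>A set \<open>A\<close> of \<open>p\<close> outside a late stage is pushed inside the bound \<open>B\<close>: as \<open>B\<close> belongs to that
      stage, the complement of \<open>B - A\<close> still lies outside it.\<close>
    obtain d where d: "d \<in> Field k" "B \<in> N d" using cover[OF B(1)] by blast
    obtain e where e: "e \<in> Field k" "(b, e) \<in> k" "(d, e) \<in> k"
      using total[OF b d(1)] total[OF b b] total[OF d(1) d(1)] b d(1) by blast
    obtain A where A: "eventually (\<lambda>m. m \<in> A) p" "A \<notin> N e" using proper[OF e(1)] by blast
    have "- (B - A) \<notin> N b"
    proof
      assume "- (B - A) \<in> N b"
      then have "- (B - A) \<in> N e" "B \<in> N e" using mono e d(2) by blast+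
      moreover have "finite (- (B - A) \<inter> B - A)" by (rule finite_subset[of _ "{}"]) auto
      ultimately show False using closed[of "- (B - A)" e B A] A by blast
    qed
    moreover have "eventually (\<lambda>m. m \<in> - (B - A)) p" using A(1) by eventually_elim auto
    moreover have "finite ((B - A) \<inter> D c)" if "c \<in> underS k b" for c
      using B(2)[OF that] by (rule finite_subset[rotated]) blast
    ultimately show ?thesis by blast
  qed blast
  have "\<exists>D. \<forall>b. b \<in> Field k \<longrightarrow> eventually (\<lambda>m. m \<in> - D b) p \<and> - D b \<notin> N b \<and>
      (\<forall>c\<in>underS k b. finite (D b \<inter> D c))"
  proof (rule dependent_wf_choice[of "k - Id"])
    show "wf (k - Id)" using wo by (simp add: well_order_on_def)
    show "(x \<in> Field k \<longrightarrow> eventually (\<lambda>m. m \<in> - r) p \<and> - r \<notin> N x \<and>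
           (\<forall>c\<in>underS k x. finite (r \<inter> f c))) =
          (x \<in> Field k \<longrightarrow> eventually (\<lambda>m. m \<in> - r) p \<and> - r \<notin> N x \<and>
           (\<forall>c\<in>underS k x. finite (r \<inter> g c)))"
      if "\<And>z. (z, x) \<in> k - Id \<Longrightarrow> f z = g z" for f g :: "'k \<Rightarrow> nat set" and x r
      using that unfolding underS_def by auto
  next
    fix x and f :: "'k \<Rightarrow> nat set"
    assume "\<And>y. (y, x) \<in> k - Id \<Longrightarrow> y \<in> Field k \<longrightarrow> eventually (\<lambda>m. m \<in> - f y) p \<and>
      - f y \<notin> N y \<and> (\<forall>c\<in>underS k y. finite (f y \<inter> f c))"
    then show "\<exists>r. x \<in> Field k \<longrightarrow> eventually (\<lambda>m. m \<in> - r) p \<and> - r \<notin> N x \<and>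
      (\<forall>c\<in>underS k x. finite (r \<inter> f c))" by (intro step) blast
  qed
  then obtain D where D: "\<And>b. b \<in> Field k \<Longrightarrow> eventually (\<lambda>m. m \<in> - D b) p"
      "\<And>b. b \<in> Field k \<Longrightarrow> - D b \<notin> N b"
      "\<And>b c. b \<in> Field k \<Longrightarrow> c \<in> underS k b \<Longrightarrow> finite (D b \<inter> D c)" by blast
  obtain col :: "'k \<Rightarrow> nat"
    where col: "\<forall>i\<le>n. \<forall>a\<in>Field k. \<exists>b\<in>Field k. col b = i \<and> (a, b) \<in> k"
    using cofinal_colouring[OF k(1,2)] ..
  interpret orthogonal_families n "Field k" D col
  proof
    fix b c assume bc: "b \<in> Field k" "c \<in> Field k" "col b \<noteq> col c"
    then have "c \<in> underS k b \<or> b \<in> underS k c"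
      using total[of b c] unfolding underS_def by auto
    then show "finite (D b \<inter> D c)" using D(3) bc by (metis Int_commute)
  qed (rule MA(2))
  have "|Field k| <o continuum"
    using ordIso_ordLess_trans[OF card_of_Field_ordIso[OF k(1)] k(3)] .
  then obtain c :: "nat \<Rightarrow> nat" where c: "\<And>m. c m \<le> n" "\<And>b. b \<in> Field k \<Longrightarrow> finite {m \<in> D b. c m = col b}"
    using separating_colouring[OF MA(1)] by blast
  have "\<exists>i\<le>n. eventually (\<lambda>m. m \<in> {m. c m = i}) p"
  proof (rule ccontr)
    assume no: "\<not> ?thesis"
    have "eventually (\<lambda>m. c m \<noteq> i) p" if "i \<in> {..n}" for i
    proof -
      have "eventually (\<lambda>m. m \<in> {m. c m = i}) p \<or> eventually (\<lambda>m. m \<notin> {m. c m = i}) p"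
        using p unfolding ultrafilter_def by blast
      then show ?thesis using no that by auto
    qed
    then have "eventually (\<lambda>m. \<forall>i\<in>{..n}. c m \<noteq> i) p" by (intro eventually_ball_finite) auto
    then have "eventually (\<lambda>m. False) p" by eventually_elim (use c(1) in auto)
    then show False using p unfolding ultrafilter_def by auto
  qed
  then obtain i where i: "i \<le> n" "eventually (\<lambda>m. m \<in> {m. c m = i}) p" by blast
  obtain a where a: "a \<in> Field k" "{m. c m = i} \<in> N a" using cover[OF i(2)] by blast
  obtain b where b: "b \<in> Field k" "col b = i" "(a, b) \<in> k" using col i(1) a(1) by blast
  have "{m. c m = i} \<in> N b" using a(2) mono[OF b(3)] by blast
  moreover have "finite ({m. c m = i} \<inter> {m. c m = i} - - D b)"
    using c(2)[OF b(1)] b(2) by (elim finite_subset[rotated]) auto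
  ultimately have "- D b \<in> N b" using closed[OF _ _ D(1)[OF b(1)]] by blast
  then show False using D(2)[OF b(1)] by blast
qed

section \<open>The cofinal type of a scalene neighbourhood filter\<close>

text \<open>Read through \<open>star\<close>, the filtration of the neighbourhood filter along its least infinite factor is a
  filtration of \<open>p\<close>, and the directedness of the neighbourhood filter is directedness of \<open>p\<close> modulo
  finite.\<close>

lemma least_factor_ge_continuum:
  assumes MA: "MA_sigma_linked n" "n \<ge> 1" and p: "p \<in> topspace beta_omega_remainder"
    and S: "set_of_regular_cardinals S"
    and PS: "cofinally_equiv (nbhd_filter p beta_omega_remainder) (prod_order S)"
    and k: "k \<in> S" "infinite (Field k)"
    and least: "\<forall>r\<in>S. infinite (Field r) \<longrightarrow> k \<le>o r"
  shows "continuum \<le>o k"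
proof (rule ccontr)
  let ?P = "nbhd_filter p beta_omega_remainder"
  assume "\<not> continuum \<le>o k"
  have Ck: "Card_order k" using regular_cardinal_Card_order[OF member_regular[OF S k(1)]] .
  then have kc: "k <o continuum"
    using \<open>\<not> continuum \<le>o k\<close> not_ordLeq_iff_ordLess[of k continuum] card_of_Well_order
    unfolding card_order_on_def continuum_def by blast
  have star: "star A \<in> Field ?P" if "eventually (\<lambda>m. m \<in> A) p" for A
    using star_neighborhood[OF p that] by (simp add: Field_nbhd_filter)
  have P_iff: "(U, V) \<in> ?P \<longleftrightarrow> U \<in> Field ?P \<and> V \<in> Field ?P \<and> V \<subseteq> U" for U V
    unfolding Field_nbhd_filter by (auto simp: nbhd_filter_def)
  obtain N where N: "\<And>a b. (a, b) \<in> k \<Longrightarrow> N a \<subseteq> N b"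
    "\<And>U. U \<in> Field ?P \<Longrightarrow> \<exists>a\<in>Field k. U \<in> N a"
    "\<And>a. a \<in> Field k \<Longrightarrow> \<exists>U\<in>Field ?P. U \<notin> N a"
    and N_closed: "\<And>a X Y Z. X \<in> N a \<Longrightarrow> Y \<in> N a \<Longrightarrow> Z \<in> Field ?P \<Longrightarrow>
       \<forall>W\<in>Field ?P. (X, W) \<in> ?P \<longrightarrow> (Y, W) \<in> ?P \<longrightarrow> (Z, W) \<in> ?P \<Longrightarrow> Z \<in> N a"
  proof (rule filtration_below_least[OF S PS k least], goal_cases)
    case (1 N)
    show ?case by (rule that[OF 1(2-5)])
  qed
  have closed: "Z \<in> N a"
    if "X \<in> N a" "Y \<in> N a" "Z \<in> Field ?P" "X \<inter> Y \<subseteq> Z" for a X Y Z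
  proof (rule N_closed[OF that(1-3)])
    show "\<forall>W\<in>Field ?P. (X, W) \<in> ?P \<longrightarrow> (Y, W) \<in> ?P \<longrightarrow> (Z, W) \<in> ?P"
      using P_iff that(3,4) by blast
  qed
  show False
  proof (rule no_short_filtration[OF MA Ck k(2) kc, of p "\<lambda>a. {A. star A \<in> N a}"])
    show "ultrafilter p" using p by (simp add: topspace_beta_omega_remainder)
    show "{A. star A \<in> N a} \<subseteq> {A. star A \<in> N b}" if "(a, b) \<in> k" for a b
      using N(1) that by blast
    show "\<exists>a\<in>Field k. A \<in> {A. star A \<in> N a}" if "eventually (\<lambda>m. m \<in> A) p" for A
      using N(2) star[OF that] by blast
    show "\<exists>A. eventually (\<lambda>m. m \<in> A) p \<and> A \<notin> {A. star A \<in> N a}" if a: "a \<in> Field k" for a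
    proof -
      obtain U where U: "U \<in> Field ?P" "U \<notin> N a" using N(3) a by blast
      then obtain A where A: "eventually (\<lambda>m. m \<in> A) p" "star A \<subseteq> U"
        using neighborhood_contains_star[of U p] by (auto simp: Field_nbhd_filter)
      have "star A \<notin> N a"
      proof
        assume "star A \<in> N a"
        then have "U \<in> N a" using closed[of "star A" a "star A" U] U(1) A(2) by blast
        then show False using U(2) by blast
      qed
      then show ?thesis using A(1) by blast
    qed
    show "C \<in> {A. star A \<in> N a}"
      if "A \<in> {A. star A \<in> N a}" "B \<in> {A. star A \<in> N a}" "eventually (\<lambda>m. m \<in> C) p"
        "finite (A \<inter> B - C)" for a A B C
    proof -
      have "star A \<inter> star B \<subseteq> star C" using that(4) by (simp flip: star_Int add: star_subset_iff)
      then have "star C \<in> N a" using closed[of "star A" a "star B" "star C"] that(1,2) star[OF that(3)] by blast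
      then show ?thesis by blast
    qed
    show "\<exists>B. eventually (\<lambda>m. m \<in> B) p \<and> (\<forall>A\<in>\<A>. finite (B - A))"
      if \<A>: "\<And>A. A \<in> \<A> \<Longrightarrow> eventually (\<lambda>m. m \<in> A) p" "|\<A>| <o k" for \<A>
    proof -
      have "star ` \<A> \<subseteq> Field ?P" using star \<A>(1) by blast
      moreover have "|star ` \<A>| <o k" by (rule ordLeq_ordLess_trans[OF card_of_image \<A>(2)])
      ultimately obtain U where U: "U \<in> Field ?P" "\<And>A. A \<in> \<A> \<Longrightarrow> (star A, U) \<in> ?P"
        using directed_below_least[OF S PS k least, of "star ` \<A>"] by blast
      then obtain B where B: "eventually (\<lambda>m. m \<in> B) p" "star B \<subseteq> U"
        using neighborhood_contains_star[of U p] by (auto simp: Field_nbhd_filter)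
      then have "finite (B - A)" if "A \<in> \<A>" for A
        using U(2)[OF that] P_iff[of "star A" U] star_subset_iff[of B A] by blast
      then show ?thesis using B(1) by blast
    qed
  qed
qed

text \<open>The sets \<open>star A\<close> with \<open>A\<close> in \<open>p\<close> form a cofinal set of size at most the continuum.\<close>

lemma factor_le_continuum:
  assumes p: "p \<in> topspace beta_omega_remainder" and S: "set_of_regular_cardinals S"
    and PS: "cofinally_equiv (nbhd_filter p beta_omega_remainder) (prod_order S)"
    and r: "r \<in> S" "infinite (Field r)"
  shows "r \<le>o continuum"
proof -
  let ?P = "nbhd_filter p beta_omega_remainder"
  have "cofinal_subset (star ` {A. eventually (\<lambda>m. m \<in> A) p}) ?P"
    unfolding cofinal_subset_def Field_nbhd_filter
  proof (intro conjI ballI)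
    show "star ` {A. eventually (\<lambda>m. m \<in> A) p} \<subseteq> neighborhoods p beta_omega_remainder"
      by (auto intro: star_neighborhood[OF p])
  next
    fix U assume U: "U \<in> neighborhoods p beta_omega_remainder"
    then obtain A where A: "eventually (\<lambda>m. m \<in> A) p" "star A \<subseteq> U"
      using neighborhood_contains_star[of U p] by blast
    then have "(U, star A) \<in> ?P" using U star_neighborhood[OF p A(1)] by (simp add: nbhd_filter_def)
    then show "\<exists>C\<in>star ` {A. eventually (\<lambda>m. m \<in> A) p}. (U, C) \<in> ?P" using A(1) by blast
  qed
  then have "r \<le>o |star ` {A. eventually (\<lambda>m. m \<in> A) p}|"
    by (rule factor_le_cofinal_set[OF S PS r])
  also have "|star ` {A. eventually (\<lambda>m. m \<in> A) p}| \<le>o continuum"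
    unfolding continuum_def by (rule ordLeq_transitive[OF card_of_image card_of_mono1]) simp
  finally show ?thesis .
qed

theorem theorem4p15:
  assumes "\<exists>n\<ge>1. MA_sigma_linked n"
  shows "\<forall>p \<in> topspace beta_omega_remainder.
           cofinally_scalene TYPE('k) (nbhd_filter p beta_omega_remainder) \<longrightarrow>
           cofinally_equiv (nbhd_filter p beta_omega_remainder) continuum"
proof (intro ballI impI)
  fix p assume p: "p \<in> topspace beta_omega_remainder"
  let ?P = "nbhd_filter p beta_omega_remainder"
  assume "cofinally_scalene TYPE('k) ?P"
  then obtain S :: "'k rel set" where S: "set_of_regular_cardinals S"
      and PS: "cofinally_equiv ?P (prod_order S)"
    unfolding cofinally_scalene_def by blast
  obtain n where n: "MA_sigma_linked n" "n \<ge> 1" using assms by blast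
  define T where "T = {r \<in> S. infinite (Field r)}"
  have "T \<noteq> {}"
  proof
    assume "T = {}"
    then obtain W where W: "W \<in> Field ?P" "\<forall>U\<in>Field ?P. (U, W) \<in> ?P"
      using greatest_if_no_infinite_factor[OF S PS] unfolding T_def by blast
    obtain U where U: "U \<in> Field ?P" "\<not> W \<subseteq> U"
      using nbhd_filter_no_greatest[OF p, of W] W(1) unfolding Field_nbhd_filter by blast
    then have "(U, W) \<in> ?P" using W(2) by blast
    then show False using U(2) by (simp add: nbhd_filter_def)
  qed
  then obtain k where k: "k \<in> T" and min: "\<And>r. r <o k \<Longrightarrow> r \<notin> T"
  proof -
    have "\<exists>k\<in>T. \<forall>r. r <o k \<longrightarrow> r \<notin> T"
      using wf_ordLess[unfolded wf_eq_minimal, rule_format, of _ T] \<open>T \<noteq> {}\<close> by blast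
    then show thesis using that by blast
  qed
  have WO: "Well_order r" if "r \<in> S" for r
    using member_regular[OF S that] unfolding regular_cardinal_def card_order_on_def by blast
  have least: "\<forall>r\<in>S. infinite (Field r) \<longrightarrow> k \<le>o r"
  proof (intro ballI impI)
    fix r assume r: "r \<in> S" "infinite (Field r)"
    have "\<not> r <o k" using min[of r] r unfolding T_def by blast
    then show "k \<le>o r" using not_ordLess_iff_ordLeq[of k r] WO r(1) k unfolding T_def by blast
  qed
  have kS: "k \<in> S" "infinite (Field k)" using k by (auto simp: T_def)
  have ge: "continuum \<le>o k" by (rule least_factor_ge_continuum[OF n p S PS kS least])
  have eq: "r =o continuum" if r: "r \<in> S" "infinite (Field r)" for r
    using factor_le_continuum[OF p S PS r] ordLeq_transitive[OF ge least[rule_format, OF r]]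
    by (simp add: ordIso_iff_ordLeq)
  have "finite (Field r)" if r: "r \<in> S" "r \<noteq> k" for r
  proof (rule ccontr)
    assume "infinite (Field r)"
    then have "r =o k"
      by (rule ordIso_transitive[OF eq[OF r(1)] ordIso_symmetric[OF eq[OF kS]]])
    then show False using S r kS(1) unfolding set_of_regular_cardinals_def by blast
  qed
  then have "order_isomorphic continuum (prod_order S)"
    by (rule prod_order_iso_single_infinite_factor[OF S kS(1) eq[OF kS]])
  then show "cofinally_equiv ?P continuum" by (rule cofinally_equiv_iso[OF PS])
qed

end
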